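(* Let $f:(\mathbb{R}^n\setminus\mathcal{C})\times U\to\mathbb{R}^n$ be continuous and such that: (a) for every pair of compact sets $\mathcal{K}\subset\mathbb{R}^n\setminus\mathcal{C}$, $U_1\subset U$, there is $L>0$ with $|f(x,u)-f(y,u)|\le L|x-y|$ for all $x,y\in\mathcal{K}$, $u\in U_1$; (b) there is a strictly increasing bijection $\nu:[0,+\infty)\to[0,+\infty)$ such that the rescaled dynamics $\bar f(x,u):=\frac{f(x,u)}{1+\nu(|u|)}$ is uniformly continuous on $\mathcal{K}\times U$ for every compact set $\mathcal{K}\subset\mathbb{R}^n\setminus\mathcal{C}$ and bounded on $(B_R(\mathcal{C})\setminus\mathcal{C})\times U$ for every $R>0$. Then the original system $\dot x=f(x,u)$, $u\in U$, is GAC to $\mathcal{C}$ if and only if the rescaled system $y'=\bar f(y,v)$, $v\in U$, is GAC to $\mathcal{C}$. In addition, for each of the two systems, being GAC to $\mathcal{C}$ is equivalent to being GAC to $\mathcal{C}$ with $U\cap\sigma$ controls for some continuous $\sigma:(0,+\infty)\to(0,+\infty)$.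
   Context: Standing setting. $\mathcal{C}\subset\mathbb{R}^n$ is a nonempty closed set with compact boundary, $U\subseteq\mathbb{R}^m$ is a closed cone, $\mathbf d(x):=\mathrm{dist}(x,\mathcal{C})$ is the Euclidean distance from $\mathcal{C}$, and $B_R(\mathcal{C}):=\{x\in\mathbb{R}^n:\mathbf d(x)\le R\}$. In the following definitions $g:(\mathbb{R}^n\setminus\mathcal{C})\times U\to\mathbb{R}^n$ is continuous; they are applied to $g=f$ and $g=\bar f$. $\mathcal{KL}$ functions (descent rates): continuous $\beta:[0,+\infty)^2\to[0,+\infty)$ such that $\beta(0,t)=0$ and $\beta(\cdot,t)$ is strictly increasing and unbounded for each $t\ge0$; $\beta(r,\cdot)$ is strictly decreasing for each $r>0$; $\beta(r,t)\to0$ as $t\to+\infty$ for each $r\ge0$. Admissible pair for $(g,U)$: a pair $(x,u)$ for which there is $T_x\in(0,+\infty]$ such that $u\in L^\infty_{loc}([0,T_x),U)$ (essentially bounded on compact subsets), $x:[0,T_x)\to\mathbb{R}^n\setminus\mathcal{C}$ is locally absolutely continuous, $\dot x(t)=g(x(t),u(t))$ for a.e. $t\in[0,T_x)$, and, if $T_x<+\infty$, $\lim_{t\to T_x^-}\mathbf d(x(t))=0$. If $T_x<+\infty$, $x$ is extended to $[0,+\infty)$ by setting $x(t):=\bar z$ for $t\ge T_x$, where $\bar z\in\partial\mathcal{C}$ is an arbitrary point of the form $\bar z=\lim_i x(\tau_i)$ for some $\tau_i\uparrow T_x$. GAC. The system $\dot x=g(x,u)$, $u\in U$, is globally asymptotically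 controllable (GAC) to $\mathcal{C}$ if there is $\beta\in\mathcal{KL}$ such that for every $z\in\mathbb{R}^n\setminus\mathcal{C}$ there is an admissible pair $(x,u)$ for $(g,U)$ with $x(0)=z$ and $\mathbf d(x(t))\le\beta(\mathbf d(z),t)$ for all $t\ge0$. Given a continuous $\sigma:(0,+\infty)\to(0,+\infty)$, it is GAC to $\mathcal{C}$ with $U\cap\sigma$ controls if there is $\beta\in\mathcal{KL}$ such that for every $z\in\mathbb{R}^n\setminus\mathcal{C}$ there is an admissible pair $(x,u)$ for $(g,U)$ with $x(0)=z$, $\mathbf d(x(t))\le\beta(\mathbf d(z),t)$ for all $t\ge0$, and $|u(t)|\le\sigma(\mathbf d(x(t)))$ for a.e. $t\in[0,T_x)$. *)

theory Defs
  imports "HOL-Analysis.Analysis"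
begin

definition KL :: "(real \<Rightarrow> real \<Rightarrow> real) set" where
  "KL = {\<beta>.
     continuous_on ({0..} \<times> {0..}) (\<lambda>(r, t). \<beta> r t) \<and>
     (\<forall>r\<ge>0. \<forall>t\<ge>0. 0 \<le> \<beta> r t) \<and>
     (\<forall>t\<ge>0. \<beta> 0 t = 0 \<and> strict_mono_on {0..} (\<lambda>r. \<beta> r t) \<and>
        \<not> bdd_above ((\<lambda>r. \<beta> r t) ` {0..})) \<and>
     (\<forall>r>0. strict_antimono_on {0..} (\<beta> r)) \<and>
     (\<forall>r\<ge>0. (\<beta> r \<longlongrightarrow> 0) at_top)}"

text \<open>The time interval \<open>[0,T)\<close>, where \<open>T\<close> may be infinite.\<close>

definition time_dom :: "ereal \<Rightarrow> real set" where
  "time_dom T = {t. 0 \<le> t \<and> ereal t < T}"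

definition Linf_loc :: "ereal \<Rightarrow> 'b::euclidean_space set \<Rightarrow> (real \<Rightarrow> 'b) set" where
  "Linf_loc T U = {u.
     u \<in> borel_measurable (lebesgue_on (time_dom T)) \<and>
     (AE t\<in>time_dom T in lebesgue. u t \<in> U) \<and>
     (\<forall>K. compact K \<and> K \<subseteq> time_dom T \<longrightarrow> (\<exists>M. AE t\<in>K in lebesgue. norm (u t) \<le> M))}"

text \<open>The epsilon-delta definition; the finite families of non-overlapping compact intervals
  are the divisions \<open>d\<close> of subsets of \<open>S\<close>.\<close>

definition abs_continuous_on :: "real set \<Rightarrow> (real \<Rightarrow> 'a::euclidean_space) \<Rightarrow> bool" where
  "abs_continuous_on S x \<longleftrightarrow>
     (\<forall>\<epsilon>>0. \<exists>\<delta>>0. \<forall>d A. d division_of A \<and> A \<subseteq> S \<and> (\<Sum>k\<in>d. Sup k - Inf k) < \<delta> \<longrightarrow>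
        (\<Sum>k\<in>d. norm (x (Sup k) - x (Inf k))) < \<epsilon>)"

definition locally_abs_continuous_on :: "real set \<Rightarrow> (real \<Rightarrow> 'a::euclidean_space) \<Rightarrow> bool" where
  "locally_abs_continuous_on S x \<longleftrightarrow> (\<forall>a b. {a..b} \<subseteq> S \<longrightarrow> abs_continuous_on {a..b} x)"

text \<open>Only the values of \<open>x\<close> and \<open>u\<close> on \<open>[0,T)\<close> matter here, and only those of \<open>g\<close> on
  \<open>(- C) \<times> U\<close>.\<close>

definition admissible_pair ::
  "'a::euclidean_space set \<Rightarrow> ('a \<times> 'b::euclidean_space \<Rightarrow> 'a) \<Rightarrow> 'b set \<Rightarrow>
   ereal \<Rightarrow> (real \<Rightarrow> 'a) \<Rightarrow> (real \<Rightarrow> 'b) \<Rightarrow> bool" where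
  "admissible_pair C g U T x u \<longleftrightarrow>
     0 < T \<and>
     u \<in> Linf_loc T U \<and>
     (\<forall>t\<in>time_dom T. x t \<notin> C) \<and>
     locally_abs_continuous_on (time_dom T) x \<and>
     (AE t\<in>time_dom T in lebesgue.
        (x has_vector_derivative g (x t, u t)) (at t within time_dom T)) \<and>
     (\<forall>b. T = ereal b \<longrightarrow> ((\<lambda>t. infdist (x t) C) \<longlongrightarrow> 0) (at_left b))"

text \<open>If \<open>T < \<infinity>\<close>, then \<open>x\<close> is constant on \<open>[T, \<infinity>)\<close>, equal to a boundary point of \<open>C\<close> that is a
  limit of \<open>x\<close> along some sequence of times increasing to \<open>T\<close>.\<close>

definition extended_beyond :: "'a::euclidean_space set \<Rightarrow> ereal \<Rightarrow> (real \<Rightarrow> 'a) \<Rightarrow> bool" where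
  "extended_beyond C T x \<longleftrightarrow>
     (\<forall>b. T = ereal b \<longrightarrow>
        (\<exists>z\<in>frontier C.
           (\<exists>\<tau>. incseq \<tau> \<and> range \<tau> \<subseteq> time_dom T \<and> \<tau> \<longlonglongrightarrow> b \<and> (\<lambda>i. x (\<tau> i)) \<longlonglongrightarrow> z) \<and>
           (\<forall>t\<ge>b. x t = z)))"

definition GAC ::
  "'a::euclidean_space set \<Rightarrow> ('a \<times> 'b::euclidean_space \<Rightarrow> 'a) \<Rightarrow> 'b set \<Rightarrow> bool" where
  "GAC C g U \<longleftrightarrow>
     (\<exists>\<beta>\<in>KL. \<forall>z. z \<notin> C \<longrightarrow>
        (\<exists>T x u. admissible_pair C g U T x u \<and> extended_beyond C T x \<and> x 0 = z \<and>
           (\<forall>t\<ge>0. infdist (x t) C \<le> \<beta> (infdist z C) t)))"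

definition GAC_controls ::
  "'a::euclidean_space set \<Rightarrow> ('a \<times> 'b::euclidean_space \<Rightarrow> 'a) \<Rightarrow> 'b set \<Rightarrow>
   (real \<Rightarrow> real) \<Rightarrow> bool" where
  "GAC_controls C g U \<sigma> \<longleftrightarrow>
     (\<exists>\<beta>\<in>KL. \<forall>z. z \<notin> C \<longrightarrow>
        (\<exists>T x u. admissible_pair C g U T x u \<and> extended_beyond C T x \<and> x 0 = z \<and>
           (\<forall>t\<ge>0. infdist (x t) C \<le> \<beta> (infdist z C) t) \<and>
           (AE t\<in>time_dom T in lebesgue. norm (u t) \<le> \<sigma> (infdist (x t) C))))"

definition rescaled ::
  "(real \<Rightarrow> real) \<Rightarrow> ('a::euclidean_space \<times> 'b::euclidean_space \<Rightarrow> 'a) \<Rightarrow> 'a \<times> 'b \<Rightarrow> 'a" where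
  "rescaled \<nu> f = (\<lambda>(x, u). f (x, u) /\<^sub>R (1 + \<nu> (norm u)))"

end

theory Submission
  imports Defs
begin

text \<open>Call a system stagewise steerable if every state between two levels \<open>r < R\<close> of the distance
  from \<open>C\<close> can be driven down to the level \<open>r\<close> by finitely many constant controls, with bounds on
  the controls and on the time that depend on \<open>r\<close> and \<open>R\<close> only, and with an overshoot that tends to
  \<open>0\<close> with \<open>R\<close>. On a segment with constant control the original and the rescaled system differ by
  a constant factor in time, so one is stagewise steerable iff the other is.

  GAC implies stagewise steerability: along a trajectory of the GAC condition, up to the time where
  it is below the level \<open>r\<close>, the control is bounded and can be replaced by a step function; by a
  contraction argument the perturbed trajectories from all nearby states stay close to the given
  one, and the annulus between the two levels is compact. Conversely, stages between the levels
  \<open>exp k\<close> and \<open>exp (k - 1)\<close> are concatenated. Since stage \<open>k\<close> takes place between \<open>exp (k - 1)\<close> and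
  an overshoot bound that vanishes as \<open>k \<longrightarrow> - \<infinity>\<close>, only finitely many stages visit a given distance,
  which yields the bound \<open>\<sigma>\<close> on the controls.\<close>

section \<open>Absolutely continuous functions\<close>

text \<open>A direct comparison of the two systems fails because a GAC control is merely measurable,
  with bounds that depend on the initial state and may blow up towards \<open>T\<close>. The time
  change with density \<open>1 + \<nu> (norm u)\<close> then distorts the descent rate in an
  uncontrolled way. Only data that are uniform on a compact annulus survive. Uniformity is gained by
  letting one step control serve a whole ball of initial states and passing to a finite subcover.

  On the way back, the two kinds of bounds play different roles. The time bounds of the stages may
  be arbitrarily bad: a descent rate may be as slow as needed, so they are absorbed into a potential
  on the integers that counts the time left before a level is passed. The overshoot bounds, in
  contrast, enter the descent rate as its values, which is why they have to vanish near
  \<open>C\<close>. Levels indexed by all integers put every initial state, however near or far, on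
  the same footing, so one rate and one control bound serve all of them.\<close>

lemma abs_continuous_on_imp_continuous_on:
  fixes x :: "real \<Rightarrow> 'a::euclidean_space"
  assumes "abs_continuous_on {a..b} x"
  shows "continuous_on {a..b} x"
proof (rule continuous_onI)
  fix s e :: real assume s: "s \<in> {a..b}" and e: "0 < e"
  obtain \<delta> where "\<delta> > 0" and \<delta>: "\<And>d A. d division_of A \<Longrightarrow> A \<subseteq> {a..b} \<Longrightarrow> (\<Sum>k\<in>d. Sup k - Inf k) < \<delta> \<Longrightarrow>
        (\<Sum>k\<in>d. norm (x (Sup k) - x (Inf k))) < e"
    using assms e unfolding abs_continuous_on_def by metis
  have *: "norm (x v - x u) < e" if "u \<in> {a..b}" "v \<in> {a..b}" "u \<le> v" "v - u < \<delta>" for u v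
  proof -
    have "{{u..v}} division_of {u..v}"
      using that division_of_self[of u v] by simp
    from \<delta>[OF this] show ?thesis using that by auto
  qed
  show "\<exists>d>0. \<forall>t\<in>{a..b}. dist t s < d \<longrightarrow> dist (x t) (x s) \<le> e"
  proof (intro exI conjI ballI impI)
    fix t assume "t \<in> {a..b}" "dist t s < \<delta>"
    then show "dist (x t) (x s) \<le> e"
      using *[of s t] *[of t s] s by (cases "s \<le> t") (auto simp: dist_norm norm_minus_commute)
  qed fact
qed

text \<open>Tags in the exceptional null set are controlled by absolute continuity, the others
  as in the classical fundamental theorem.\<close>

theorem fundamental_theorem_of_calculus_abs_continuous:
  fixes x :: "real \<Rightarrow> 'a::euclidean_space"
  assumes "a \<le> b" and ac: "abs_continuous_on {a..b} x" and N: "negligible N"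
    and der: "\<And>t. t \<in> {a..b} - N \<Longrightarrow> (x has_vector_derivative h t) (at t within {a..b})"
  shows "(h has_integral x b - x a) {a..b}"
proof -
  \<comment> \<open>The value 0 on \<open>N\<close> leaves only the increments of \<open>x\<close>
    to be estimated at tags in \<open>N\<close>, where nothing is known about
    \<open>h\<close>.\<close>
  define h' where "h' = (\<lambda>t. if t \<in> N then 0 else h t)"
  have "(h' has_integral x b - x a) (cbox a b)"
    unfolding has_integral
  proof (intro allI impI)
    fix e :: real assume e: "0 < e"
    \<comment> \<open>Half of \<open>e\<close> is spent on the tags outside \<open>N\<close>, half
      on those in \<open>N\<close>. The summand 1 covers the case \<open>a = b\<close>.\<close>
    define e' where "e' = e / (2 * (b - a + 1))"
    have e': "e' > 0" "e' * (b - a) \<le> e / 2"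
      using e \<open>a \<le> b\<close> by (auto simp: e'_def field_simps)
    obtain \<delta> where "\<delta> > 0" and \<delta>: "\<And>d A. d division_of A \<Longrightarrow> A \<subseteq> {a..b} \<Longrightarrow> (\<Sum>k\<in>d. Sup k - Inf k) < \<delta> \<Longrightarrow>
        (\<Sum>k\<in>d. norm (x (Sup k) - x (Inf k))) < e / 2"
      using ac e unfolding abs_continuous_on_def by (metis half_gt_zero)
    obtain O' where O': "open O'" "N \<subseteq> O'" "O' \<in> lmeasurable" "measure lebesgue O' < \<delta>"
    proof -
      have Nl: "N \<in> lmeasurable" "measure lebesgue N = 0"
        using N by (auto simp: negligible_iff_measure)
      obtain T where T: "open T" "N \<subseteq> T" "T - N \<in> lmeasurable" "emeasure lebesgue (T - N) < ennreal \<delta>"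
        using sets_lebesgue_outer_open[of N \<delta>] Nl \<open>\<delta> > 0\<close> by (metis fmeasurableD)
      then have TN: "measure lebesgue (T - N) < \<delta>"
        by (metis \<open>\<delta> > 0\<close> emeasure_eq_measure2 ennreal_less_iff measure_nonneg)
      have TT: "T = (T - N) \<union> N" using T by auto
      have "T \<in> lmeasurable" using T(3) Nl(1) TT by (metis fmeasurable.Un)
      moreover have "measure lebesgue T \<le> measure lebesgue (T - N) + measure lebesgue N"
        using measure_Un_le[of "T - N" lebesgue N] TT T(3) Nl(1) by (metis fmeasurableD)
      ultimately show ?thesis using that T TN Nl by force
    qed
    \<comment> \<open>Intervals tagged in \<open>N\<close> are kept inside \<open>O'\<close>, so
      their total length is below \<open>\<delta>\<close>. At the other tags the gauge is fine
      enough for the linear approximation of \<open>x\<close>.\<close>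
    have "\<forall>t. \<exists>d>0. (t \<in> {a..b} - N \<longrightarrow>
         (\<forall>y\<in>{a..b}. norm (y-t) < d \<longrightarrow> norm (x y - x t - (y-t) *\<^sub>R h t) \<le> e' * norm (y-t)))
         \<and> (t \<in> N \<longrightarrow> ball t d \<subseteq> O')"
    proof
      fix t
      show "\<exists>d>0. (t \<in> {a..b} - N \<longrightarrow>
         (\<forall>y\<in>{a..b}. norm (y-t) < d \<longrightarrow> norm (x y - x t - (y-t) *\<^sub>R h t) \<le> e' * norm (y-t)))
         \<and> (t \<in> N \<longrightarrow> ball t d \<subseteq> O')"
      proof (cases "t \<in> N")
        case True
        then show ?thesis using O'(1,2) by (auto simp: open_contains_ball)
      next
        case False
        then show ?thesis
          using der[of t, unfolded has_vector_derivative_def has_derivative_within_alt] e'(1)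
          by (cases "t \<in> {a..b}") (auto intro: exI[of _ 1])
      qed
    qed
    then obtain d where d: "\<And>t. 0 < d t"
        "\<And>t y. \<lbrakk>t \<in> {a..b} - N; y \<in> {a..b}; norm (y-t) < d t\<rbrakk>
              \<Longrightarrow> norm (x y - x t - (y-t) *\<^sub>R h t) \<le> e' * norm (y-t)"
        "\<And>t. t \<in> N \<Longrightarrow> ball t (d t) \<subseteq> O'"
      by metis
    show "\<exists>\<gamma>. gauge \<gamma> \<and> (\<forall>p. p tagged_division_of cbox a b \<and> \<gamma> fine p \<longrightarrow>
         norm ((\<Sum>(t, k)\<in>p. measure lborel k *\<^sub>R h' t) - (x b - x a)) < e)"
    proof (rule exI, safe)
      show "gauge (\<lambda>t. ball t (d t))"
        using d(1) gauge_ball_dependent by blast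
      fix p
      assume ptag: "p tagged_division_of cbox a b" and finep: "(\<lambda>t. ball t (d t)) fine p"
      have finp: "finite p" using ptag by blast
      have ba: "b - a = (\<Sum>(t,K)\<in>p. Sup K - Inf K)" "x b - x a = (\<Sum>(t,K)\<in>p. x(Sup K) - x(Inf K))"
        using additive_tagged_division_1[where f= "\<lambda>t. t"] additive_tagged_division_1[where f= x]
            \<open>a \<le> b\<close> ptag by auto
      have term_le: "norm (measure lborel K *\<^sub>R h' t - (x (Sup K) - x (Inf K)))
          \<le> e' * (Sup K - Inf K) + (if t \<in> N then norm (x (Sup K) - x (Inf K)) else 0)"
        if tK: "(t, K) \<in> p" for t K
      proof -
        have "t \<in> K" and kab: "K \<subseteq> cbox a b"
          using ptag tK by blast+
        then obtain u v where k: "K = cbox u v"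
          using ptag tK by auto
        have "u \<le> v" using \<open>t \<in> K\<close> unfolding k by auto
        have ball: "\<forall>y\<in>K. y \<in> ball t (d t)"
          using finep tK by blast
        have uv: "u \<in> K" "v \<in> K"
          by (simp_all add: \<open>u \<le> v\<close> k)
        show ?thesis
        proof (cases "t \<in> N")
          case True
          then show ?thesis using e'(1) \<open>u \<le> v\<close> by (simp add: h'_def k norm_minus_commute)
        next
          case False
          have "norm ((v - u) *\<^sub>R h t - (x v - x u)) = norm (x u - x t - (u - t) *\<^sub>R h t - (x v - x t - (v - t) *\<^sub>R h t))"
            by (auto simp: algebra_simps)
          also have "\<dots> \<le> norm (x u - x t - (u - t) *\<^sub>R h t) + norm (x v - x t - (v - t) *\<^sub>R h t)"
            by (rule norm_triangle_ineq4)
          also have "\<dots> \<le> e' * norm (u - t) + e' * norm (v - t)"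
            using uv ball kab \<open>t \<in> K\<close> False
            by (intro add_mono d) (auto simp: dist_real_def abs_minus_commute)
          also have "\<dots> = e' * (v - u)"
            using \<open>t \<in> K\<close> by (auto simp: k field_simps)
          finally show ?thesis using False \<open>u \<le> v\<close> by (simp add: h'_def k)
        qed
      qed
      define p' where "p' = {(t, K) \<in> p. t \<in> N}"
      have p'p: "p' \<subseteq> p" by (auto simp: p'_def)
      have p't: "p' tagged_division_of (\<Union>(snd ` p'))"
        using tagged_partial_division_of_Union_self[OF tagged_partial_division_subset[OF _ p'p]] ptag
        by (auto simp: tagged_division_of_def)
      have p'd: "(snd ` p') division_of (\<Union>(snd ` p'))"
        by (rule division_of_tagged_division[OF p't])
      have sub: "\<Union>(snd ` p') \<subseteq> {a..b}"
        using ptag p'p by fastforce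
      have subO: "\<Union>(snd ` p') \<subseteq> O'"
      proof -
        have "K \<subseteq> O'" if "(t,K) \<in> p" "t \<in> N" for t K
          using finep that d(3)[of t] by (fastforce simp: fine_def)
        then show ?thesis unfolding p'_def by fastforce
      qed
      have "(\<Sum>K\<in>snd ` p'. Sup K - Inf K) = (\<Sum>K\<in>snd ` p'. measure lebesgue K)"
      proof (rule sum.cong)
        fix K assume "K \<in> snd ` p'"
        then obtain u v where "K = cbox u v" "K \<noteq> {}" using division_ofD(3,4)[OF p'd] by metis
        then show "Sup K - Inf K = measure lebesgue K" by (auto simp: measure_completion)
      qed simp
      also have "\<dots> = measure lebesgue (\<Union>(snd ` p'))"
        using content_division[OF p'd] by simp
      also have "\<dots> \<le> measure lebesgue O'"
        using subO O'(3) lmeasurable_division[OF p'd] by (intro measure_mono_fmeasurable) auto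
      finally have "(\<Sum>K\<in>snd ` p'. Sup K - Inf K) < \<delta>" using O'(4) by simp
      then have lt: "(\<Sum>K\<in>snd ` p'. norm (x (Sup K) - x (Inf K))) < e / 2"
        by (rule \<delta>[OF p'd sub])
      \<comment> \<open>Two tags can share an interval only if its interior is empty, and there the
        increment of \<open>x\<close> vanishes. \<open>\<phi>\<close> sets the value at the empty
        set, where \<open>Sup\<close> and \<open>Inf\<close> carry no information.\<close>
      have eq: "(\<Sum>(t, K)\<in>p'. norm (x (Sup K) - x (Inf K))) = (\<Sum>K\<in>snd ` p'. norm (x (Sup K) - x (Inf K)))"
      proof -
        define \<phi> where "\<phi> = (\<lambda>K. if K = {} then 0 else norm (x (Sup K) - x (Inf K)))"
        have "(\<Sum>(t, K)\<in>p'. \<phi> K) = (\<Sum>K\<in>snd ` p'. \<phi> K)"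
          by (rule sum.over_tagged_division_lemma[OF p't])
             (auto simp: \<phi>_def dest: order_antisym)
        moreover have "(\<Sum>(t, K)\<in>p'. \<phi> K) = (\<Sum>(t, K)\<in>p'. norm (x (Sup K) - x (Inf K)))"
          using p't by (intro sum.cong) (auto simp: \<phi>_def)
        moreover have "(\<Sum>K\<in>snd ` p'. \<phi> K) = (\<Sum>K\<in>snd ` p'. norm (x (Sup K) - x (Inf K)))"
          using division_ofD(3)[OF p'd] by (intro sum.cong) (auto simp: \<phi>_def)
        ultimately show ?thesis by simp
      qed
      have "norm ((\<Sum>(t, k)\<in>p. measure lborel k *\<^sub>R h' t) - (x b - x a))
         = norm (\<Sum>(t, K) \<in> p. (measure lborel K *\<^sub>R h' t) - (x (Sup K) - x (Inf K)))"
        by (simp add: ba split_def sum_subtractf)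
      also have "\<dots> \<le> (\<Sum>(t,K)\<in>p. e' * (Sup K - Inf K) + (if t \<in> N then norm (x (Sup K) - x (Inf K)) else 0))"
        using term_le by (intro sum_norm_le) auto
      also have "\<dots> = e' * (b - a) + (\<Sum>(t,K)\<in>p. (if t \<in> N then norm (x (Sup K) - x (Inf K)) else 0))"
        by (simp add: ba split_def sum.distrib sum_distrib_left)
      also have "(\<Sum>(t,K)\<in>p. (if t \<in> N then norm (x (Sup K) - x (Inf K)) else 0))
          = (\<Sum>(t,K)\<in>p'. norm (x (Sup K) - x (Inf K)))"
        unfolding p'_def using finp by (intro sum.mono_neutral_cong_right) (auto split: if_splits)
      finally show "norm ((\<Sum>(t, k)\<in>p. measure lborel k *\<^sub>R h' t) - (x b - x a)) < e"
        using lt eq e'(2) by linarith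
    qed
  qed
  then have "(h' has_integral x b - x a) {a..b}" by simp
  then show ?thesis
    by (rule has_integral_spike[OF N, rotated]) (auto simp: h'_def)
qed

section \<open>Chains of constant controls\<close>

text \<open>With one constant control per segment, a change of time scale depending on the control is
  affine on each segment, so no measurable time change is needed.\<close>

inductive steer :: "('a::euclidean_space \<times> 'b::euclidean_space \<Rightarrow> 'a) \<Rightarrow> ('a \<times> 'b) set \<Rightarrow>
    real \<Rightarrow> 'a \<Rightarrow> 'a \<Rightarrow> bool" for g W where
  rest: "steer g W 0 z z"
| step: "steer g W t z (x 0) \<Longrightarrow> 0 \<le> h \<Longrightarrow>
    (\<And>s. s \<in> {0..h} \<Longrightarrow> (x s, c) \<in> W \<and> (x has_vector_derivative g (x s, c)) (at s within {0..h})) \<Longrightarrow>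
    steer g W (t + h) z (x h)"

lemma steer_nonneg: "steer g W t z z' \<Longrightarrow> 0 \<le> t"
  by (induction rule: steer.induct) auto

lemma steer_positive:
  assumes "steer g W t z z'" "z' \<noteq> z"
  shows "0 < t"
  using assms
proof (induction rule: steer.induct)
  case (step t z x h c)
  then show ?case using steer_nonneg[OF step.hyps(1)] by (cases "h = 0") auto
qed simp

lemma steer_mono:
  assumes "steer g W t z z'" "W \<subseteq> W'"
  shows "steer g W' t z z'"
  using assms
proof (induction rule: steer.induct)
  case (step t z x h c)
  then show ?case by (intro steer.step[where c=c]) auto
qed (rule steer.rest)

text \<open>Under a frozen control both systems trace the same curve, so
  \<open>y s = x (r * s)\<close> only changes the duration of a segment from \<open>h\<close> to
  \<open>h / r\<close>. The points and controls visited are the same, hence the same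
  \<open>W\<close>.\<close>

lemma steer_time_change:
  assumes "steer g W t z z'"
    and scale: "\<And>x u. (x, u) \<in> W \<Longrightarrow> g' (x, u) = \<rho> u *\<^sub>R g (x, u) \<and> 0 < \<rho> u \<and> 1 / \<rho> u \<le> m"
  shows "\<exists>t'\<le>m * t. steer g' W t' z z'"
  using assms(1)
proof (induction rule: steer.induct)
  case (rest z)
  then show ?case by (auto intro!: exI[of _ 0] steer.rest)
next
  case (step t z x h c)
  then obtain t' where t': "t' \<le> m * t" "steer g' W t' z (x 0)" by blast
  define r where "r = \<rho> c"
  have r: "0 < r" "1 / r \<le> m" "\<And>s. s \<in> {0..h} \<Longrightarrow> g' (x s, c) = r *\<^sub>R g (x s, c)"
    using scale[of "x _" c] step.hyps(2,3) by (force simp: r_def)+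
  define y where "y = (\<lambda>s. x (r * s))"
  have "steer g' W (t' + h / r) z (y (h / r))"
  proof (rule steer.step[where c = c])
    show "steer g' W t' z (y 0)" using t' by (simp add: y_def)
    show "0 \<le> h / r" using step.hyps r by simp
    fix s assume s: "s \<in> {0..h / r}"
    have im: "(*) r ` {0..h / r} = {0..h}"
      using r(1) step.hyps(2) by (simp add: image_mult_atLeastAtMost)
    have rs: "r * s \<in> {0..h}" using s r(1) im by blast
    have "((*) r has_vector_derivative r) (at s within {0..h/r})"
      by (auto intro!: derivative_eq_intros simp: has_vector_derivative_def)
    moreover have "(x has_vector_derivative g (x (r * s), c)) (at (r * s) within (*) r ` {0..h / r})"
      using step.hyps(3)[OF rs] im by simp
    ultimately have "(x \<circ> (*) r has_vector_derivative r *\<^sub>R g (x (r * s), c)) (at s within {0..h/r})"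
      by (rule vector_diff_chain_within)
    then show "(y s, c) \<in> W \<and> (y has_vector_derivative g' (y s, c)) (at s within {0..h / r})"
      using step.hyps(3)[OF rs] r(3)[OF rs] by (simp add: y_def o_def)
  qed
  moreover have "y (h / r) = x h" using r by (simp add: y_def)
  moreover have "t' + h / r \<le> m * (t + h)"
    using t'(1) mult_right_mono[OF r(2) step.hyps(2)] by (simp add: algebra_simps)
  ultimately show ?case by auto
qed

text \<open>Membership in \<open>W\<close> is asked on a half-open interval: the control at the end
  time stays free and is fixed by the next segment. The finite exceptional set holds the switching
  times.\<close>

definition traj :: "('a::euclidean_space \<times> 'b::euclidean_space \<Rightarrow> 'a) \<Rightarrow> ('a \<times> 'b) set \<Rightarrow>
    real \<Rightarrow> (real \<Rightarrow> 'a) \<Rightarrow> (real \<Rightarrow> 'b) \<Rightarrow> bool" where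
  "traj g W t x u \<longleftrightarrow> 0 \<le> t \<and> (\<exists>L. L-lipschitz_on {0..t} x) \<and>
     (\<exists>F. finite F \<and> (\<forall>s\<in>{0<..<t} - F. (x has_vector_derivative g (x s, u s)) (at s))) \<and>
     u \<in> borel_measurable borel \<and> bounded (range u) \<and> (\<forall>s\<in>{0..<t}. (x s, u s) \<in> W)"

lemma lipschitz_on_solution:
  assumes "0 \<le> h" and g: "continuous_on W g"
    and x: "\<And>s. s \<in> {0..h} \<Longrightarrow> (x s, c) \<in> W \<and> (x has_vector_derivative g (x s, c)) (at s within {0..h})"
  shows "\<exists>L. L-lipschitz_on {0..h} x"
proof -
  have cx: "continuous_on {0..h} x"
    using x by (meson continuous_on_eq_continuous_within has_vector_derivative_continuous)
  have "continuous_on {0..h} (\<lambda>s. g (x s, c))"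
    by (rule continuous_on_compose2[OF g]) (use x in \<open>auto intro!: continuous_intros cx\<close>)
  then have "bounded ((\<lambda>s. g (x s, c)) ` {0..h})"
    by (intro compact_imp_bounded compact_continuous_image) auto
  then obtain B where B: "B > 0" "\<And>s. s \<in> {0..h} \<Longrightarrow> norm (g (x s, c)) \<le> B"
    by (auto simp: bounded_pos)
  have "B-lipschitz_on {0..h} x"
  proof (rule lipschitz_onI)
    fix s t assume "s \<in> {0..h}" "t \<in> {0..h}"
    then have "norm (x s - x t) \<le> B * norm (s - t)"
      using x B
      by (intro differentiable_bound[of "{0..h}" x "\<lambda>s r. r *\<^sub>R g (x s, c)"])
         (auto simp: has_vector_derivative_def mult.commute[of B] intro!: onorm_le mult_left_mono)
    then show "dist (x s) (x t) \<le> B * dist s t" by (simp add: dist_norm)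
  qed (use B in auto)
  then show ?thesis ..
qed

text \<open>The segments of the chain are glued on one at a time. The last conclusion remembers the
  smaller set \<open>W'\<close> on the new piece: when stages are concatenated, it carries the
  overshoot bound of the current stage, while \<open>W\<close> is common to all stages.\<close>

lemma traj_extend:
  assumes "steer g W' t' z z'" "traj g W t x u" "x t = z" "W' \<subseteq> W" and g: "continuous_on W' g"
  shows "\<exists>x2 u2. traj g W (t + t') x2 u2 \<and> x2 (t + t') = z' \<and> (\<forall>s\<le>t. x2 s = x s) \<and>
    (\<forall>s<t. u2 s = u s) \<and> (\<forall>s\<in>{t..<t+t'}. (x2 s, u2 s) \<in> W')"
  using assms(1-4)
proof (induction rule: steer.induct)
  case (rest z)
  then show ?case by (intro exI[of _ x] exI[of _ u]) auto
next
  case (step t' z y h c)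
  then obtain x2 u2 where x2: "traj g W (t + t') x2 u2" "x2 (t + t') = y 0" "\<And>s. s\<le>t \<Longrightarrow> x2 s = x s"
    "\<And>s. s<t \<Longrightarrow> u2 s = u s" "\<And>s. s\<in>{t..<t+t'} \<Longrightarrow> (x2 s, u2 s) \<in> W'" by blast
  define a where "a = t + t'"
  have a0: "0 \<le> a" "t \<le> a" using x2(1) steer_nonneg[OF step.hyps(1)] by (auto simp: traj_def a_def)
  \<comment> \<open>At the junction \<open>a\<close> the two curves agree, so \<open>x3\<close> may
    use either. The control must switch at \<open>a\<close> already, since the old one is
    constrained only before \<open>a\<close>.\<close>
  define x3 where "x3 = (\<lambda>s. if s \<le> a then x2 s else y (s - a))"
  define u3 where "u3 = (\<lambda>s. if s < a then u2 s else c)"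
  obtain L1 F where L1: "L1-lipschitz_on {0..a} x2" and F: "finite F"
    "\<And>s. s \<in> {0<..<a} - F \<Longrightarrow> (x2 has_vector_derivative g (x2 s, u2 s)) (at s)"
    and u2: "u2 \<in> borel_measurable borel" "bounded (range u2)"
    and W2: "\<And>s. s \<in> {0..<a} \<Longrightarrow> (x2 s, u2 s) \<in> W"
    using x2(1) unfolding traj_def a_def by blast
  obtain L2 where L2: "L2-lipschitz_on {0..h} y"
    using lipschitz_on_solution[OF step.hyps(2) g] step.hyps(3) by blast
  have x3y: "x3 s = y (s - a)" if "s \<ge> a" for s
    using that x2(2) by (auto simp: x3_def a_def)
  have "traj g W (a + h) x3 u3"
    unfolding traj_def
  proof (intro conjI)
    show "0 \<le> a + h" using a0 step.hyps by simp
    have L2': "(L2)-lipschitz_on {a..a+h} (\<lambda>s. y (s - a))"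
    proof (rule lipschitz_onI)
      fix r s assume "r \<in> {a..a+h}" "s \<in> {a..a+h}"
      then show "dist (y (r - a)) (y (s - a)) \<le> L2 * dist r s"
        using lipschitz_onD[OF L2, of "r - a" "s - a"] by (simp add: dist_norm)
    qed (use L2 in \<open>auto simp: lipschitz_on_def\<close>)
    have "(max L1 L2)-lipschitz_on {0..a+h} x3"
      unfolding x3_def using L1 L2' x2(2)
      by (intro lipschitz_on_concat) (auto simp: a_def intro: lipschitz_on_mono)
    then show "\<exists>L. L-lipschitz_on {0..a+h} x3" ..
    show "\<exists>F. finite F \<and> (\<forall>s\<in>{0<..<a + h} - F. (x3 has_vector_derivative g (x3 s, u3 s)) (at s))"
    proof (intro exI conjI ballI)
      show "finite (insert a F)" using F by simp
      fix s assume s: "s \<in> {0<..<a + h} - insert a F"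
      show "(x3 has_vector_derivative g (x3 s, u3 s)) (at s)"
      proof (cases "s < a")
        case True
        have "(x2 has_vector_derivative g (x3 s, u3 s)) (at s)"
          using F(2)[of s] True s by (simp add: x3_def u3_def)
        then show ?thesis
          by (rule has_vector_derivative_transform_within_open[of _ _ _ "{..<a}"])
             (use True in \<open>auto simp: x3_def\<close>)
      next
        case False
        with s have s': "s - a \<in> {0<..<h}" "s > a" by auto
        have "(y has_vector_derivative g (y (s - a), c)) (at (s - a))"
          using step.hyps(3)[of "s - a"] s'
          by (metis at_within_Icc_at atLeastAtMost_iff greaterThanLessThan_iff less_eq_real_def)
        moreover have "((\<lambda>s. s - a) has_vector_derivative 1) (at s)"
          by (auto intro!: derivative_eq_intros)
        ultimately have "(y \<circ> (\<lambda>s. s - a) has_vector_derivative 1 *\<^sub>R g (y (s - a), c)) (at s)"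
          by (intro vector_diff_chain_at)
        then have "((\<lambda>s. y (s - a)) has_vector_derivative g (x3 s, u3 s)) (at s)"
          using s' by (simp add: o_def x3_def u3_def)
        then show ?thesis
          by (rule has_vector_derivative_transform_within_open[of _ _ _ "{a<..}"])
             (use s' in \<open>auto simp: x3_def\<close>)
      qed
    qed
    show "u3 \<in> borel_measurable borel" unfolding u3_def using u2 by measurable
    have "range u3 \<subseteq> insert c (range u2)" by (auto simp: u3_def)
    then show "bounded (range u3)" using u2 by (meson bounded_insert bounded_subset)
    show "\<forall>s\<in>{0..<a + h}. (x3 s, u3 s) \<in> W"
    proof
      fix s assume "s \<in> {0..<a+h}"
      then show "(x3 s, u3 s) \<in> W"
        using W2[of s] x3y[of s] step.hyps(3)[of "s - a"] step.prems(3)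
        by (cases "s < a") (auto simp: x3_def u3_def)
    qed
  qed
  moreover have "x3 (a + h) = y h" using x3y[of "a+h"] step.hyps by simp
  moreover have "x3 s = x s" if "s \<le> t" for s using that x2(3) a0 by (simp add: x3_def)
  moreover have "u3 s = u s" if "s < t" for s using that x2(4) a0 by (simp add: u3_def)
  moreover have "(x3 s, u3 s) \<in> W'" if "s \<in> {t..<a+h}" for s
    using x2(5)[of s] x3y[of s] step.hyps(3)[of "s - a"] that
    by (cases "s < a") (auto simp: x3_def u3_def a_def)
  ultimately show ?case unfolding a_def add.assoc by blast
qed

section \<open>Perturbed trajectories\<close>

lemma AE_lebesgue_negligible:
  assumes "AE s\<in>S in lebesgue. P s"
  obtains Z where "negligible Z" "\<And>s. s \<in> S - Z \<Longrightarrow> P s"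
proof -
  obtain Z where Z: "{s \<in> space lebesgue. \<not> (s \<in> S \<longrightarrow> P s)} \<subseteq> Z" "emeasure lebesgue Z = 0" "Z \<in> sets lebesgue"
    using assms by (rule AE_E)
  show thesis
  proof
    show "negligible Z" using Z by (simp add: negligible_iff_null_sets null_setsI)
  qed (use Z(1) in auto)
qed

text \<open>A measurable function is almost everywhere a limit of continuous functions
  \<open>G n\<close>. Uniform continuity allows each \<open>G n\<close> to be frozen on a grid of
  mesh \<open>1 / N n\<close> with error below \<open>1 / Suc n\<close>.\<close>

lemma step_function_approximation:
  fixes u :: "real \<Rightarrow> 'b::euclidean_space"
  assumes u: "u \<in> borel_measurable (lebesgue_on {0..b})" and V: "closed V" "V \<noteq> {}"
    and uV: "AE s\<in>{0..b} in lebesgue. u s \<in> V"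
  obtains N :: "nat \<Rightarrow> nat" and q :: "nat \<Rightarrow> int \<Rightarrow> 'b" and Z where "negligible Z"
    "\<And>n. 0 < N n" "\<And>n i. q n i \<in> V" "\<And>s. s \<in> {0..b} - Z \<Longrightarrow> u s \<in> V"
    "\<And>s. s \<in> {0..b} - Z \<Longrightarrow> (\<lambda>n. q n \<lfloor>real (N n) * s\<rfloor>) \<longlonglongrightarrow> u s"
proof -
  have "u measurable_on {0..b}"
    using u by (subst measurable_on_iff_borel_measurable) auto
  then obtain Z G where Z: "negligible Z" and G: "\<And>n::nat. continuous_on UNIV (G n)"
    and GZ: "\<And>s. s \<notin> Z \<Longrightarrow> (\<lambda>n. G n s) \<longlonglongrightarrow> (if s \<in> {0..b} then u s else 0)"
    unfolding measurable_on_def by blast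
  obtain Z' where Z': "negligible Z'" "\<And>s. s \<in> {0..b} - Z' \<Longrightarrow> u s \<in> V"
    using AE_lebesgue_negligible[OF uV] by blast
  have "\<exists>N>0. \<forall>s\<in>{0..b}. dist (G n (\<lfloor>real N * s\<rfloor> / real N)) (G n s) < 1 / real (Suc n)" for n
  proof -
    have "uniformly_continuous_on {0..b} (G n)"
      using G continuous_on_subset by (intro compact_uniformly_continuous) blast+
    then obtain d where d: "d > 0" "\<And>s t. s \<in> {0..b} \<Longrightarrow> t \<in> {0..b} \<Longrightarrow> dist t s < d \<Longrightarrow>
        dist (G n t) (G n s) < 1 / real (Suc n)"
      unfolding uniformly_continuous_on_def by (metis of_nat_0_less_iff zero_less_Suc zero_less_divide_1_iff)
    obtain N where N: "N > 0" "1 / real N < d"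
      using d(1) by (metis nat_approx_posE of_nat_Suc zero_less_Suc)
    have "dist (G n (\<lfloor>real N * s\<rfloor> / real N)) (G n s) < 1 / real (Suc n)" if s: "s \<in> {0..b}" for s
    proof (rule d(2)[OF s])
      have f: "of_int \<lfloor>real N * s\<rfloor> \<le> real N * s" "real N * s < of_int \<lfloor>real N * s\<rfloor> + 1"
        by linarith+
      have "0 \<le> \<lfloor>real N * s\<rfloor>" using s by simp
      moreover have "\<lfloor>real N * s\<rfloor> / real N \<le> s" "s < \<lfloor>real N * s\<rfloor> / real N + 1 / real N"
        using f N(1) by (simp_all add: field_simps)
      ultimately show "\<lfloor>real N * s\<rfloor> / real N \<in> {0..b}" "dist (\<lfloor>real N * s\<rfloor> / real N) s < d"
        using s N by (auto simp: dist_real_def)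
    qed
    then show ?thesis using N(1) by blast
  qed
  then obtain N where N: "\<And>n. N n > 0"
    "\<And>n s. s\<in>{0..b} \<Longrightarrow> dist (G n (\<lfloor>real (N n) * s\<rfloor> / real (N n))) (G n s) < 1 / real (Suc n)"
    by metis
  \<comment> \<open>\<open>V\<close> need not be convex, so the projection may be discontinuous. But
    \<open>u s\<close> lies in \<open>V\<close>, so a nearest point is no farther from the projected
    point than \<open>u s\<close> is, and projecting at most doubles the error. Hence the factor 2
    below.\<close>
  define q where "q = (\<lambda>n i. closest_point V (G n (of_int i / real (N n))))"
  show thesis
  proof
    show "negligible (Z \<union> Z')" using Z Z' by simp
    show "q n i \<in> V" for n i using V by (auto simp: q_def closest_point_in_set)
    fix s assume s: "s \<in> {0..b} - (Z \<union> Z')"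
    then show us: "u s \<in> V" using Z' by blast
    let ?p = "\<lambda>n. G n (\<lfloor>real (N n) * s\<rfloor> / real (N n))"
    have "(\<lambda>n. G n s) \<longlonglongrightarrow> u s" using GZ[of s] s by simp
    then have "(\<lambda>n. dist (G n s) (u s)) \<longlonglongrightarrow> 0"
      by (rule tendsto_dist_iff[THEN iffD1])
    then have "(\<lambda>n. 2 * (1 / real (Suc n) + dist (G n s) (u s))) \<longlonglongrightarrow> 2 * (0 + 0)"
      by (intro tendsto_intros LIMSEQ_Suc[OF lim_1_over_n])
    then have lim: "(\<lambda>n. 2 * (1 / real (Suc n) + dist (G n s) (u s))) \<longlonglongrightarrow> 0" by simp
    have "dist (q n \<lfloor>real (N n) * s\<rfloor>) (u s) \<le> 2 * (1 / real (Suc n) + dist (G n s) (u s))" for n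
    proof -
      have "dist (?p n) (q n \<lfloor>real (N n) * s\<rfloor>) \<le> dist (?p n) (u s)"
        unfolding q_def by (rule closest_point_le[OF V(1) us])
      moreover have "dist (?p n) (u s) \<le> dist (?p n) (G n s) + dist (G n s) (u s)"
        by (rule dist_triangle)
      moreover have "dist (q n \<lfloor>real (N n) * s\<rfloor>) (u s) \<le> dist (?p n) (q n \<lfloor>real (N n) * s\<rfloor>) + dist (?p n) (u s)"
        by (rule dist_triangle3)
      ultimately show ?thesis using N(2)[of s n] s by auto
    qed
    then have "(\<lambda>n. dist (q n \<lfloor>real (N n) * s\<rfloor>) (u s)) \<longlonglongrightarrow> 0"
      by (intro tendsto_sandwich[OF _ _ tendsto_const lim]) auto
    then show "(\<lambda>n. q n \<lfloor>real (N n) * s\<rfloor>) \<longlonglongrightarrow> u s" by (rule tendsto_dist_iff[THEN iffD2])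
  qed (use N in auto)
qed

text \<open>Weighting by \<open>exp (- 2 L t)\<close> makes the Picard operator a contraction with factor 1/2 on
  the whole interval.\<close>

lemma picard_global:
  fixes G :: "real \<Rightarrow> 'a::euclidean_space \<Rightarrow> 'a"
  assumes b: "0 \<le> b" and L: "0 < L"
    and lip: "\<And>s v w. s \<in> {0..b} \<Longrightarrow> norm (G s v - G s w) \<le> L * norm (v - w)"
    and int: "\<And>w. continuous_on {0..b} w \<Longrightarrow> (\<lambda>s. G s (w s)) integrable_on {0..b}"
    and small: "\<And>t. t \<in> {0..b} \<Longrightarrow> norm (integral {0..t} (\<lambda>s. G s 0)) \<le> \<eta>"
  obtains w where "continuous_on {0..b} w"
    "\<And>t. t \<in> {0..b} \<Longrightarrow> w t = v0 + integral {0..t} (\<lambda>s. G s (w s))"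
    "\<And>t. t \<in> {0..b} \<Longrightarrow> norm (w t) \<le> 2 * exp (2 * L * b) * (norm v0 + \<eta>)"
proof -
  define E where "E = (\<lambda>s. exp (2 * L * s))"
  have E0: "E s > 0" for s by (simp add: E_def)
  have contE: "continuous_on S E" for S unfolding E_def by (intro continuous_intros)
  \<comment> \<open>The unknown \<open>w\<close> is the solution divided by the weight
    \<open>E\<close>, so the plain supremum norm of \<open>w\<close> is the weighted norm of the
    solution.\<close>
  define F where "F = (\<lambda>(w::real \<Rightarrow>\<^sub>C 'a) t. (v0 + integral {0..t} (\<lambda>s. G s (E s *\<^sub>R w s))) /\<^sub>R E t)"
  have contw: "continuous_on S (\<lambda>s. E s *\<^sub>R w s)" for S and w :: "real \<Rightarrow>\<^sub>C 'a"
    by (intro continuous_on_scaleR contE) simp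
  have intw: "(\<lambda>s. G s (E s *\<^sub>R w s)) integrable_on {0..t}" if "t \<in> {0..b}" for w :: "real \<Rightarrow>\<^sub>C 'a" and t
    by (rule integrable_on_subinterval[OF int[OF contw]]) (use that in auto)
  have int0: "(\<lambda>s. G s 0) integrable_on {0..t}" if "t \<in> {0..b}" for t
    by (rule integrable_on_subinterval[OF int[OF continuous_on_const]]) (use that in auto)
  \<comment> \<open>Continuing \<open>F w\<close> by constants outside \<open>{0..b}\<close> makes
    it a bounded continuous function on the line, an element of a complete space as Banach's theorem
    requires.\<close>
  have "\<exists>g::real \<Rightarrow>\<^sub>C 'a. \<forall>t. g t = F w (clamp 0 b t)" for w
  proof -
    have "continuous_on (cbox 0 b) (F w)"
      unfolding F_def using E0 intw[of b w] b
      by (auto intro!: continuous_intros contE indefinite_integral_continuous_1 simp: less_imp_neq[THEN not_sym])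
    then show ?thesis by (metis continuous_on_cbox_bcontfunE)
  qed
  then obtain \<Phi> :: "(real \<Rightarrow>\<^sub>C 'a) \<Rightarrow> real \<Rightarrow>\<^sub>C 'a" where \<Phi>: "\<And>w t. \<Phi> w t = F w (clamp 0 b t)"
    by metis
  have clampb: "clamp 0 b t \<in> {0..b}" for t
    using clamp_in_interval[of 0 b t] b by auto
  \<comment> \<open>The derivative of \<open>E\<close> is \<open>2 * L * E\<close>, so integration
    absorbs \<open>L\<close> and leaves the contraction factor 1/2.\<close>
  have expint: "((\<lambda>s. L * (E s * D)) has_integral (E t * D / 2 - D / 2)) {0..t}" if "0 \<le> t" for t D
  proof -
    have "((\<lambda>s. L * (E s * D)) has_integral (E t * D / 2 - E 0 * D / 2)) {0..t}"
      unfolding E_def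
      by (rule fundamental_theorem_of_calculus[OF that])
         (auto intro!: derivative_eq_intros simp: has_real_derivative_iff_has_vector_derivative[symmetric])
    then show ?thesis by (simp add: E_def)
  qed
  \<comment> \<open>\<open>k\<close> is kept general: a second weighted function gives the
    contraction, the zero function gives the bound on the solution.\<close>
  have diff: "norm (integral {0..t} (\<lambda>s. G s (E s *\<^sub>R w s)) - integral {0..t} (\<lambda>s. G s (k s))) \<le> E t * D / 2"
    if t: "t \<in> {0..b}" and k: "(\<lambda>s. G s (k s)) integrable_on {0..t}" 
      and D: "\<And>s. s \<in> {0..b} \<Longrightarrow> norm (E s *\<^sub>R w s - k s) \<le> E s * D" "0 \<le> D"
    for t D k and w :: "real \<Rightarrow>\<^sub>C 'a"
  proof -
    have "norm (integral {0..t} (\<lambda>s. G s (E s *\<^sub>R w s)) - integral {0..t} (\<lambda>s. G s (k s)))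
        = norm (integral {0..t} (\<lambda>s. G s (E s *\<^sub>R w s) - G s (k s)))"
      using intw[OF t] k by (simp add: integral_diff)
    also have "\<dots> \<le> integral {0..t} (\<lambda>s. L * (E s * D))"
    proof (rule integral_norm_bound_integral)
      show "(\<lambda>s. G s (E s *\<^sub>R w s) - G s (k s)) integrable_on {0..t}"
        using intw[OF t] k by (rule integrable_diff)
      show "(\<lambda>s. L * (E s * D)) integrable_on {0..t}" using expint t by fastforce
      fix s assume "s \<in> {0..t}"
      then have s: "s \<in> {0..b}" using t by auto
      show "norm (G s (E s *\<^sub>R w s) - G s (k s)) \<le> L * (E s * D)"
        using lip[OF s, of "E s *\<^sub>R w s" "k s"] mult_left_mono[OF D(1)[OF s], of L] L by linarith
    qed
    also have "\<dots> = E t * D / 2 - D / 2"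
      using expint[of t] t by (intro integral_unique) auto
    finally show ?thesis using D(2) by simp
  qed
  have "\<forall>w1 w2. dist (\<Phi> w1) (\<Phi> w2) \<le> 1 / 2 * dist w1 w2"
  proof (intro allI dist_bound)
    fix w1 w2 :: "real \<Rightarrow>\<^sub>C 'a" and t'
    define t where "t = clamp 0 b t'"
    have t: "t \<in> {0..b}" using clampb by (simp add: t_def)
    have "norm (integral {0..t} (\<lambda>s. G s (E s *\<^sub>R w1 s)) - integral {0..t} (\<lambda>s. G s (E s *\<^sub>R w2 s))) \<le> E t * dist w1 w2 / 2"
    proof (rule diff[OF t intw[OF t]])
      fix s
      have "norm (E s *\<^sub>R w1 s - E s *\<^sub>R w2 s) = E s * dist (w1 s) (w2 s)"
        using E0[of s] by (simp add: dist_norm flip: scaleR_diff_right)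
      then show "norm (E s *\<^sub>R w1 s - E s *\<^sub>R w2 s) \<le> E s * dist w1 w2"
        using dist_bounded[of w1 s w2] E0[of s] by simp
    qed simp
    then have "norm (integral {0..t} (\<lambda>s. G s (E s *\<^sub>R w1 s)) - integral {0..t} (\<lambda>s. G s (E s *\<^sub>R w2 s))) / E t \<le> dist w1 w2 / 2"
      using E0[of t] by (simp add: field_simps)
    moreover have "dist (\<Phi> w1 t') (\<Phi> w2 t') = norm (integral {0..t} (\<lambda>s. G s (E s *\<^sub>R w1 s)) - integral {0..t} (\<lambda>s. G s (E s *\<^sub>R w2 s))) / E t"
      using E0[of t] unfolding \<Phi> t_def[symmetric] F_def
      by (simp add: dist_norm divide_inverse mult.commute flip: scaleR_diff_right)
    ultimately show "dist (\<Phi> w1 t') (\<Phi> w2 t') \<le> 1 / 2 * dist w1 w2" by simp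
  qed
  then obtain w where w: "\<Phi> w = w"
    using banach_fix_type[of "1/2" \<Phi>] by auto
  define W where "W = (\<lambda>s. E s *\<^sub>R w s)"
  have weq: "w t = F w t" if "t \<in> {0..b}" for t
    using \<Phi>[of w t] that by (simp add: w)
  have Weq: "W t = v0 + integral {0..t} (\<lambda>s. G s (W s))" if "t \<in> {0..b}" for t
    using weq[OF that] E0[of t] by (simp add: W_def F_def)
  \<comment> \<open>Comparison with the zero function. Half of \<open>norm w\<close> returns on the
    right and is absorbed, which explains the factor 2 in the final bound.\<close>
  have wn: "norm (w t) \<le> norm v0 + \<eta> + norm w / 2" for t
  proof -
    define t' where "t' = clamp 0 b t"
    have t': "t' \<in> {0..b}" using clampb by (simp add: t'_def)
    have ww: "w t = w t'" using \<Phi>[of w t] weq[OF t'] by (simp add: w t'_def)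
    have "norm (integral {0..t'} (\<lambda>s. G s (E s *\<^sub>R w s)) - integral {0..t'} (\<lambda>s. G s 0)) \<le> E t' * norm w / 2"
      using E0 norm_bounded[of w] by (intro diff[OF t' int0[OF t']]) (auto simp: less_imp_le)
    moreover have "norm (integral {0..t'} (\<lambda>s. G s 0)) \<le> \<eta>" by (rule small[OF t'])
    ultimately have "norm (v0 + integral {0..t'} (\<lambda>s. G s (E s *\<^sub>R w s))) \<le> (norm v0 + \<eta>) + E t' * norm w / 2"
      using norm_triangle_ineq[of v0 "integral {0..t'} (\<lambda>s. G s (E s *\<^sub>R w s))"]
        norm_triangle_sub[of "integral {0..t'} (\<lambda>s. G s (E s *\<^sub>R w s))" "integral {0..t'} (\<lambda>s. G s 0)"]
      by linarith
    then have "norm (W t') \<le> (norm v0 + \<eta>) + E t' * norm w / 2"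
      using Weq[OF t'] by (simp add: W_def)
    moreover have "1 \<le> E t'" using t' L by (simp add: E_def)
    then have "norm v0 + \<eta> \<le> E t' * (norm v0 + \<eta>)"
      using small[OF t'] norm_ge_zero[of v0] norm_ge_zero[of "integral {0..t'} (\<lambda>s. G s 0)"]
      by (metis add_nonneg_nonneg mult_left_mono mult.commute mult.right_neutral order_trans)
    moreover have "norm (W t') = E t' * norm (w t)" using E0[of t'] by (simp add: W_def ww)
    ultimately have "E t' * norm (w t) \<le> E t' * (norm v0 + \<eta> + norm w / 2)"
      by (simp add: algebra_simps)
    then show ?thesis using E0[of t'] by simp
  qed
  then have "norm w \<le> norm v0 + \<eta> + norm w / 2" by (rule norm_bound)
  then have nw: "norm w \<le> 2 * (norm v0 + \<eta>)" by simp
  show thesis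
  proof
    show "continuous_on {0..b} W" unfolding W_def by (rule contw)
    fix t assume t: "t \<in> {0..b}"
    show "W t = v0 + integral {0..t} (\<lambda>s. G s (W s))" by (rule Weq[OF t])
    have "norm (W t) = E t * norm (w t)" using E0[of t] by (simp add: W_def)
    also have "\<dots> \<le> E b * (2 * (norm v0 + \<eta>))"
      using norm_bounded[of w t] nw t L E0 by (intro mult_mono) (auto simp: E_def)
    finally show "norm (W t) \<le> 2 * exp (2 * L * b) * (norm v0 + \<eta>)"
      by (simp add: E_def algebra_simps)
  qed
qed

text \<open>Between consecutive grid points the control is frozen, so the integrand is continuous
  there and the integral equation yields a classical derivative. Each grid cell becomes one segment
  of the chain, the last one cut off at \<open>t\<close>.\<close>

lemma step_control_steer:
  fixes g :: "'a::euclidean_space \<times> 'b::euclidean_space \<Rightarrow> 'a" and N :: nat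
  assumes b: "0 \<le> b" and N: "0 < N" and y: "continuous_on {0..b} y"
    and q: "\<And>i. q i \<in> V"
    and g: "\<And>c. c \<in> V \<Longrightarrow> continuous_on {0..b} (\<lambda>s. g (y s, c))"
    and int: "(\<lambda>s. g (y s, q \<lfloor>real N * s\<rfloor>)) integrable_on {0..b}"
    and sol: "\<And>t. t \<in> {0..b} \<Longrightarrow> y t = z + integral {0..t} (\<lambda>s. g (y s, q \<lfloor>real N * s\<rfloor>))"
    and t: "t \<in> {0..b}"
  shows "steer g (y ` {0..t} \<times> V) t z (y t)"
proof -
  have "\<forall>t\<in>{0..b}. t \<le> real n / real N \<longrightarrow> steer g (y ` {0..t} \<times> V) t z (y t)" for n
  proof (induction n)
    case 0
    show ?case using sol[of 0] b by (auto intro: steer.rest)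
  next
    case (Suc n)
    show ?case
    proof (intro ballI impI)
      fix t assume t: "t \<in> {0..b}" "t \<le> real (Suc n) / real N"
      show "steer g (y ` {0..t} \<times> V) t z (y t)"
      proof (cases "t \<le> real n / real N")
        case True
        then show ?thesis using Suc t by blast
      next
        case False
        define t0 where "t0 = real n / real N"
        have t0: "0 \<le> t0" "t0 < t" "t0 \<le> b" using False t by (auto simp: t0_def)
        define x where "x = (\<lambda>s. y (t0 + s))"
        have fl: "\<lfloor>real N * s\<rfloor> = int n" if "s \<in> {t0..<t}" for s
        proof -
          have "s * real N < t * real N" using that N by (intro mult_strict_right_mono) auto
          moreover have "t * real N \<le> real (Suc n)" "real n \<le> real N * s"
            using that t(2) N by (auto simp: t0_def field_simps)
          ultimately have "real n \<le> real N * s" "real N * s < real (Suc n)"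
            by (simp_all add: mult.commute)
          then show ?thesis by linarith
        qed
        let ?k = "\<lambda>s. g (y s, q (int n))"
        have yr: "y r = y t0 + integral {t0..r} ?k" if r: "r \<in> {t0..t}" for r
        proof -
          \<comment> \<open>The floor may jump at the right end \<open>t\<close> of the cell, so the
            two integrands agree only up to that point.\<close>
          have "integral {t0..r} (\<lambda>s. g (y s, q \<lfloor>real N * s\<rfloor>)) = integral {t0..r} ?k"
            by (rule integral_spike[of "{t}"]) (use fl r in auto)
          moreover have "integral {0..t0} (\<lambda>s. g (y s, q \<lfloor>real N * s\<rfloor>)) + integral {t0..r} (\<lambda>s. g (y s, q \<lfloor>real N * s\<rfloor>))
              = integral {0..r} (\<lambda>s. g (y s, q \<lfloor>real N * s\<rfloor>))"
            by (intro Henstock_Kurzweil_Integration.integral_combine integrable_on_subinterval[OF int]) (use t0 r t in auto)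
          ultimately show ?thesis using sol[of t0] sol[of r] t0 r t by auto
        qed
        have contk: "continuous_on {t0..t} ?k"
          using g[OF q, of "int n"] by (rule continuous_on_subset) (use t0 t in auto)
        have "steer g (y ` {0..t} \<times> V) (t0 + (t - t0)) z (x (t - t0))"
        proof (rule steer.step[where c = "q (int n)"])
          have "steer g (y ` {0..t0} \<times> V) t0 z (y t0)" using Suc t0 by (simp add: t0_def)
          moreover have "y ` {0..t0} \<times> V \<subseteq> y ` {0..t} \<times> V"
            using t0 by (intro Sigma_mono image_mono) auto
          ultimately show "steer g (y ` {0..t} \<times> V) t0 z (x 0)"
            unfolding x_def by (simp add: steer_mono)
          show "0 \<le> t - t0" using t0 by simp
          fix s assume s: "s \<in> {0..t - t0}"
          have der: "((\<lambda>r. y t0 + integral {t0..r} ?k) has_vector_derivative ?k (t0 + s)) (at (t0 + s) within {t0..t})"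
            using s t0 has_vector_derivative_add[OF has_vector_derivative_const
                integral_has_vector_derivative[OF contk, of "t0 + s"], of "y t0"] by simp
          have "(y has_vector_derivative ?k (t0 + s)) (at (t0 + s) within {t0..t})"
            by (rule has_vector_derivative_transform[OF _ yr der]) (use s in auto)
          moreover have "(+) t0 ` {0..t - t0} = {t0..t}" by simp
          moreover have "((+) t0 has_vector_derivative 1) (at s within {0..t - t0})"
            by (auto intro!: derivative_eq_intros simp: has_vector_derivative_def)
          ultimately have "(y \<circ> (+) t0 has_vector_derivative 1 *\<^sub>R ?k (t0 + s)) (at s within {0..t - t0})"
            by (intro vector_diff_chain_within) auto
          then show "(x s, q (int n)) \<in> y ` {0..t} \<times> V \<and>
              (x has_vector_derivative g (x s, q (int n))) (at s within {0..t - t0})"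
            using q s t0 by (auto simp: x_def o_def)
        qed
        then show ?thesis by (simp add: x_def)
      qed
    qed
  qed
  moreover have "t \<le> real (nat \<lceil>t * real N\<rceil>) / real N"
  proof -
    have "t * real N \<le> real (nat \<lceil>t * real N\<rceil>)" by linarith
    then show ?thesis using N by (simp add: field_simps)
  qed
  ultimately show ?thesis using t by blast
qed

lemma Icc_subset_time_dom:
  assumes "ereal b < T"
  shows "{0..b} \<subseteq> time_dom T"
proof
  fix s assume "s \<in> {0..b}"
  then show "s \<in> time_dom T"
    using le_less_trans[of "ereal s" "ereal b" T] assms by (simp add: time_dom_def)
qed

text \<open>The perturbed trajectory is sought as \<open>x + w\<close> under a step control
  \<open>Q n\<close> that is the same for all \<open>z\<close> in the ball. Then \<open>w\<close>
  starts at \<open>z - x 0\<close> and is driven by the error \<open>e n\<close> of replacing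
  \<open>u\<close> by \<open>Q n\<close>, which tends to 0 in the mean by dominated convergence. The
  bound of the Picard theorem keeps \<open>w\<close> within \<open>\<delta>\<close>.\<close>

lemma perturbed_steering:
  fixes g :: "'a::euclidean_space \<times> 'b::euclidean_space \<Rightarrow> 'a"
  assumes U: "closed U" and g: "continuous_on ((- C) \<times> U) g"
    and lip: "\<And>K U1. compact K \<Longrightarrow> K \<subseteq> - C \<Longrightarrow> compact U1 \<Longrightarrow> U1 \<subseteq> U \<Longrightarrow>
              \<exists>L>0. \<forall>x\<in>K. \<forall>y\<in>K. \<forall>u\<in>U1. norm (g (x, u) - g (y, u)) \<le> L * norm (x - y)"
    and adm: "admissible_pair C g U T x u"
    and b: "0 < b" "ereal b < T" and "0 < \<delta>"
    and tube: "\<And>s. s \<in> {0..b} \<Longrightarrow> cball (x s) \<delta> \<subseteq> - C"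
  obtains M \<rho> where "0 < \<rho>"
    "\<And>z. z \<in> ball (x 0) \<rho> \<Longrightarrow> \<exists>y. continuous_on {0..b} y \<and> y 0 = z \<and>
       (\<forall>s\<in>{0..b}. dist (y s) (x s) \<le> \<delta>) \<and>
       (\<forall>t\<in>{0..b}. steer g (y ` {0..t} \<times> (U \<inter> cball 0 M)) t z (y t))"
proof -
  have sub: "{0..b} \<subseteq> time_dom T"
    using b(2) by (rule Icc_subset_time_dom)
  have ac: "abs_continuous_on {0..t} x" if "t \<in> {0..b}" for t
  proof -
    have "{0..t} \<subseteq> time_dom T" using sub that by auto
    then show ?thesis using adm unfolding admissible_pair_def locally_abs_continuous_on_def by blast
  qed
  have contx: "continuous_on {0..b} x"
    using ac[of b] b by (intro abs_continuous_on_imp_continuous_on) auto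
  define h where "h = (\<lambda>s. g (x s, u s))"
  have "AE s\<in>time_dom T in lebesgue. (x has_vector_derivative h s) (at s within time_dom T)"
    using adm unfolding admissible_pair_def h_def by blast
  from AE_lebesgue_negligible[OF this] obtain Z1 where Z1: "negligible Z1" "\<And>s. s \<in> time_dom T - Z1 \<Longrightarrow>
      (x has_vector_derivative h s) (at s within time_dom T)"
    by blast
  have h: "(h has_integral x t - x 0) {0..t}" if t: "t \<in> {0..b}" for t
  proof (rule fundamental_theorem_of_calculus_abs_continuous[OF _ ac[OF t] Z1(1)])
    fix s assume "s \<in> {0..t} - Z1"
    then show "(x has_vector_derivative h s) (at s within {0..t})"
      using sub t by (intro has_vector_derivative_within_subset[OF Z1(2)]) auto
  qed (use t in auto)
  have uL: "u \<in> Linf_loc T U" using adm by (simp add: admissible_pair_def)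
  then obtain M where M: "AE s\<in>{0..b} in lebesgue. norm (u s) \<le> M"
    using sub compact_Icc[of 0 b] unfolding Linf_loc_def by blast
  define V where "V = U \<inter> cball 0 M"
  have V: "compact V" "V \<subseteq> U" using U by (auto simp: V_def closed_Int_compact)
  obtain Z2 where Z2: "negligible Z2" "\<And>s. s \<in> {0..b} - Z2 \<Longrightarrow> norm (u s) \<le> M"
    using AE_lebesgue_negligible[OF M] by blast
  have "AE s\<in>time_dom T in lebesgue. u s \<in> U" using uL unfolding Linf_loc_def by blast
  from AE_lebesgue_negligible[OF this]
  obtain Z3 where Z3: "negligible Z3" "\<And>s. s \<in> time_dom T - Z3 \<Longrightarrow> u s \<in> U"
    by blast
  have uV: "u s \<in> V" if "s \<in> {0..b} - (Z2 \<union> Z3)" for s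
    using that Z2(2)[of s] Z3(2)[of s] sub by (auto simp: V_def)
  have AEV: "AE s\<in>{0..b} in lebesgue. u s \<in> V"
  proof (rule AE_I')
    show "Z2 \<union> Z3 \<in> null_sets lebesgue" using Z2(1) Z3(1) by (simp flip: negligible_iff_null_sets)
  qed (use uV in auto)
  \<comment> \<open>Almost all values of \<open>u\<close> on an interval of positive length lie in
    \<open>V\<close>, so \<open>V\<close> is nonempty, as the projection onto it requires.\<close>
  have "\<not> negligible {0..b}" using b negligible_interval(1)[of 0 b] by simp
  then have "\<not> {0..b} \<subseteq> Z2 \<union> Z3"
    using Z2(1) Z3(1) negligible_subset negligible_Un by metis
  then obtain v0 where v0: "v0 \<in> V" using uV by blast
  have um: "u \<in> borel_measurable (lebesgue_on {0..b})"
    using uL sub unfolding Linf_loc_def by (auto intro: measurable_restrict_mono)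
  have "closed V" "V \<noteq> {}" using V(1) v0 by (auto intro: compact_imp_closed)
  then obtain N :: "nat \<Rightarrow> nat" and q Z where Z: "negligible Z" and Nq: "\<And>n. 0 < N n" "\<And>n i. q n i \<in> V"
    and uZ: "\<And>s. s \<in> {0..b} - Z \<Longrightarrow> u s \<in> V"
    and conv: "\<And>s. s \<in> {0..b} - Z \<Longrightarrow> (\<lambda>n. q n \<lfloor>real (N n) * s\<rfloor>) \<longlonglongrightarrow> u s"
    by (rule step_function_approximation[OF um _ _ AEV]) (assumption | rule that)+
  define Q where "Q = (\<lambda>n s. q n \<lfloor>real (N n) * s\<rfloor>)"
  have Qm: "Q n \<in> borel_measurable borel" for n unfolding Q_def by measurable
  have QV: "Q n s \<in> V" for n s using Nq by (simp add: Q_def)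
  \<comment> \<open>The closed tube of radius \<open>\<delta>\<close> around the trajectory. Its
    compactness gives one bound \<open>B\<close> and one Lipschitz constant
    \<open>L\<close>.\<close>
  define K where "K = {p + v | p v. p \<in> x ` {0..b} \<and> v \<in> cball 0 \<delta>}"
  have K: "compact K" unfolding K_def by (intro compact_sums compact_continuous_image contx) auto
  have KC: "K \<subseteq> - C"
    using tube by (force simp: K_def dist_norm)
  have inK: "p \<in> K" if "s \<in> {0..b}" "dist p (x s) \<le> \<delta>" for p s
  proof -
    have "p = x s + (p - x s)" "p - x s \<in> cball 0 \<delta>" using that by (auto simp: dist_norm norm_minus_commute)
    then show ?thesis using that(1) unfolding K_def by blast
  qed
  have xK: "x s \<in> K" if "s \<in> {0..b}" for s using inK[OF that] \<open>0 < \<delta>\<close> by simp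
  have gKV: "continuous_on (K \<times> V) g"
    using g by (rule continuous_on_subset) (use KC V in auto)
  have "bounded (g ` (K \<times> V))"
    by (intro compact_imp_bounded compact_continuous_image gKV compact_Times K V)
  then obtain B where B: "B > 0" "\<And>p v. p \<in> K \<Longrightarrow> v \<in> V \<Longrightarrow> norm (g (p, v)) \<le> B"
    by (auto simp: bounded_pos)
  obtain L where L: "L > 0" "\<And>p p' v. p \<in> K \<Longrightarrow> p' \<in> K \<Longrightarrow> v \<in> V \<Longrightarrow>
      norm (g (p, v) - g (p', v)) \<le> L * norm (p - p')"
    using lip[OF K KC V] by blast
  have int: "(\<lambda>s. g (p s, Q n s)) integrable_on {0..b}"
    if p: "continuous_on {0..b} p" "\<And>s. s \<in> {0..b} \<Longrightarrow> p s \<in> K" for p n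
  proof (rule measurable_bounded_by_integrable_imp_integrable[of _ _ "\<lambda>_. B"])
    \<comment> \<open>\<open>g\<close> is continuous only on a part of the space. Restricted to a
      compact set and extended by 0 it is Borel everywhere, so compositions with it are
      measurable.\<close>
    define g' where "g' = (\<lambda>z. if z \<in> K \<times> V then g z else 0)"
    have g': "g' \<in> borel_measurable borel"
      unfolding g'_def using K V
      by (intro borel_measurable_continuous_on_if gKV continuous_on_const)
         (auto intro!: borel_closed compact_imp_closed compact_Times)
    have pm: "p \<in> borel_measurable (lebesgue_on {0..b})"
      using p(1) by (rule continuous_imp_measurable_on_sets_lebesgue) simp
    have "Q n \<in> borel_measurable lebesgue" using Qm[of n] by (simp add: measurable_completion)
    then have Qm': "Q n \<in> borel_measurable (lebesgue_on {0..b})"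
      by (rule measurable_restrict_space1)
    have "(\<lambda>s. g' (p s, Q n s)) \<in> borel_measurable (lebesgue_on {0..b})"
      by (rule measurable_compose[OF borel_measurable_Pair[OF pm Qm'] g'])
    then show "(\<lambda>s. g (p s, Q n s)) \<in> borel_measurable (lebesgue_on {0..b})"
      by (rule measurable_cong[THEN iffD1, rotated]) (use p QV in \<open>auto simp: g'_def\<close>)
    show "norm (g (p s, Q n s)) \<le> B" if "s \<in> {0..b}" for s
      using B(2) p(2)[OF that] QV by blast
  qed auto
  \<comment> \<open>The change on the null set \<open>Z\<close> makes the bound \<open>B\<close>
    hold at every time and not just almost everywhere.\<close>
  define h' where "h' = (\<lambda>s. if s \<in> Z then 0 else h s)"
  have h': "(h' has_integral x t - x 0) {0..t}" if t: "t \<in> {0..b}" for t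
    by (rule has_integral_spike[OF Z _ h[OF t]]) (auto simp: h'_def)
  have h'int: "h' integrable_on {0..t}" if "t \<in> {0..b}" for t using h'[OF that] by blast
  have h'B: "norm (h' s) \<le> B" if "s \<in> {0..b}" for s
    using B xK[OF that] uZ[of s] that by (auto simp: h'_def h_def)
  define e where "e = (\<lambda>n s. g (x s, Q n s) - h' s)"
  have eint: "e n integrable_on {0..b}" for n
    unfolding e_def using b by (intro integrable_diff int contx xK h'int) auto
  have eB: "norm (e n s) \<le> 2 * B" if "s \<in> {0..b}" for n s
  proof -
    have "norm (e n s) \<le> norm (g (x s, Q n s)) + norm (h' s)" unfolding e_def by (rule norm_triangle_ineq4)
    then show ?thesis using h'B[OF that] B(2)[OF xK[OF that] QV, of n s] by linarith
  qed
  have neint: "(\<lambda>s. norm (e n s)) integrable_on {0..b}" for n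
  proof (rule measurable_bounded_by_integrable_imp_integrable[of _ _ "\<lambda>_. 2 * B"])
    show "(\<lambda>s. norm (e n s)) \<in> borel_measurable (lebesgue_on {0..b})"
      using integrable_imp_measurable[OF eint] by measurable
  qed (use eB in auto)
  define f where "f = (\<lambda>n s. if s \<in> Z then 0 else norm (e n s))"
  have "(\<lambda>n. integral {0..b} (f n)) \<longlonglongrightarrow> integral {0..b} (\<lambda>_. 0)"
  proof (rule dominated_convergence(2)[of _ _ "\<lambda>_. 2 * B"])
    show "f n integrable_on {0..b}" for n
      by (rule integrable_spike[OF neint[of n] Z]) (auto simp: f_def)
    show "norm (f n s) \<le> 2 * B" if "s \<in> {0..b}" for n s
      using eB[OF that, of n] B(1) by (simp add: f_def)
    fix s assume s: "s \<in> {0..b}"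
    show "(\<lambda>n. f n s) \<longlonglongrightarrow> 0"
    proof (cases "s \<in> Z")
      case False
      have "(\<lambda>n. g (x s, Q n s)) \<longlonglongrightarrow> g (x s, u s)"
      proof (rule continuous_on_tendsto_compose[OF gKV])
        show "(\<lambda>n. (x s, Q n s)) \<longlonglongrightarrow> (x s, u s)"
          using conv[of s] False s unfolding Q_def by (intro tendsto_Pair tendsto_const) auto
      qed (use s False uZ xK QV in auto)
      then have "(\<lambda>n. e n s) \<longlonglongrightarrow> g (x s, u s) - h' s"
        unfolding e_def by (intro tendsto_diff tendsto_const)
      then have "(\<lambda>n. norm (e n s)) \<longlonglongrightarrow> 0"
        using False by (intro tendsto_norm_zero) (simp add: h'_def h_def)
      then show ?thesis using False by (simp add: f_def)
    qed (simp add: f_def)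
  qed auto
  then have limf: "(\<lambda>n. integral {0..b} (f n)) \<longlonglongrightarrow> 0" by simp
  \<comment> \<open>Chosen so that the Picard bound
    \<open>2 * exp (2 * L * b) * (\<eta> + \<eta>)\<close> equals \<open>\<delta>\<close>: one
    \<open>\<eta>\<close> is the radius of the ball, the other bounds the integrated error.\<close>
  define \<eta> where "\<eta> = \<delta> / (4 * exp (2 * L * b))"
  have \<eta>: "\<eta> > 0" using \<open>0 < \<delta>\<close> by (simp add: \<eta>_def)
  obtain n where n: "integral {0..b} (f n) < \<eta>"
    using order_tendstoD(2)[OF limf \<eta>] by (auto simp: eventually_sequentially)
  have small: "norm (integral {0..t} (e n)) \<le> \<eta>" if t: "t \<in> {0..b}" for t
  proof -
    have "norm (integral {0..t} (e n)) \<le> integral {0..t} (\<lambda>s. norm (e n s))"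
      by (rule integral_norm_bound_integral)
         (use t in \<open>auto intro: integrable_on_subinterval[OF eint] integrable_on_subinterval[OF neint]\<close>)
    also have "\<dots> \<le> integral {0..b} (\<lambda>s. norm (e n s))"
      by (rule integral_subset_le)
         (use t in \<open>auto intro: integrable_on_subinterval[OF neint]\<close>)
    also have "\<dots> = integral {0..b} (f n)"
      by (rule integral_spike[OF Z]) (auto simp: f_def)
    finally show ?thesis using n by simp
  qed
  \<comment> \<open>The Picard theorem needs a right-hand side that is Lipschitz for all
    displacements. Clipping to the \<open>\<delta>\<close>-ball keeps the argument in
    \<open>K\<close>, and the resulting bound \<open>norm (w t) \<le> \<delta>\<close> shows
    afterwards that nothing was clipped.\<close>
  define clip where "clip = closest_point (cball (0::'a) \<delta>)"
  have clip: "norm (clip v) \<le> \<delta>" "norm v \<le> \<delta> \<Longrightarrow> clip v = v" for v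
    using closest_point_in_set[of "cball (0::'a) \<delta>" v] closest_point_self[of v "cball (0::'a) \<delta>"] \<open>0 < \<delta>\<close>
    by (auto simp: clip_def)
  have cliplip: "norm (clip v - clip w) \<le> norm (v - w)" for v w
    using closest_point_lipschitz[of "cball (0::'a) \<delta>" v w] \<open>0 < \<delta>\<close>
    by (auto simp: clip_def dist_norm)
  have clipcont: "continuous_on S clip" for S
    unfolding clip_def using \<open>0 < \<delta>\<close> by (intro continuous_on_closest_point) auto
  have clipK: "x s + clip v \<in> K" if "s \<in> {0..b}" for s v
    using inK[OF that] clip(1)[of v] by (simp add: dist_norm)
  have clip0: "clip 0 = 0" using clip(2)[of 0] \<open>0 < \<delta>\<close> by simp
  define G where "G = (\<lambda>s v. g (x s + clip v, Q n s) - h' s)"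
  show thesis
  proof
    show "0 < \<eta>" by fact
    fix z assume z: "z \<in> ball (x 0) \<eta>"
    obtain w where w: "continuous_on {0..b} w"
      "\<And>t. t \<in> {0..b} \<Longrightarrow> w t = (z - x 0) + integral {0..t} (\<lambda>s. G s (w s))"
      "\<And>t. t \<in> {0..b} \<Longrightarrow> norm (w t) \<le> 2 * exp (2 * L * b) * (norm (z - x 0) + \<eta>)"
    proof (rule picard_global[of b L G \<eta> "z - x 0"])
      show "norm (G s v - G s w) \<le> L * norm (v - w)" if "s \<in> {0..b}" for s v w
      proof -
        have "norm (G s v - G s w) \<le> L * norm (clip v - clip w)"
          using L(2)[OF clipK[OF that, of v] clipK[OF that, of w] QV[of n s]] by (simp add: G_def)
        also have "\<dots> \<le> L * norm (v - w)" using L(1) cliplip by simp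
        finally show ?thesis .
      qed
      show "(\<lambda>s. G s (w s)) integrable_on {0..b}" if w: "continuous_on {0..b} w" for w
        unfolding G_def
        by (intro integrable_diff int h'int continuous_on_add contx clipK
            continuous_on_compose2[OF clipcont w]) (use b in auto)
      show "norm (integral {0..t} (\<lambda>s. G s 0)) \<le> \<eta>" if "t \<in> {0..b}" for t
        using small[OF that] by (simp add: G_def e_def clip0)
    qed (use b L in auto)
    have wd: "norm (w t) \<le> \<delta>" if "t \<in> {0..b}" for t
    proof -
      have "norm (z - x 0) \<le> \<eta>" using z by (simp add: dist_norm norm_minus_commute)
      then have "2 * exp (2 * L * b) * (norm (z - x 0) + \<eta>) \<le> 2 * exp (2 * L * b) * (\<eta> + \<eta>)"
        by simp
      also have "\<dots> = \<delta>" by (simp add: \<eta>_def)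
      finally show ?thesis using w(3)[OF that] by linarith
    qed
    define y where "y = (\<lambda>s. x s + w s)"
    have conty: "continuous_on {0..b} y" unfolding y_def by (intro continuous_intros contx w)
    have yK: "y s \<in> K" if "s \<in> {0..b}" for s
      using inK[OF that] wd[OF that] by (simp add: y_def dist_norm)
    have yint: "(\<lambda>s. g (y s, Q n s)) integrable_on {0..b}" by (rule int[OF conty yK])
    have sol: "y t = z + integral {0..t} (\<lambda>s. g (y s, Q n s))" if t: "t \<in> {0..b}" for t
    proof -
      have "integral {0..t} (\<lambda>s. G s (w s)) = integral {0..t} (\<lambda>s. g (y s, Q n s) - h' s)"
        by (rule integral_cong) (use t wd clip(2) in \<open>auto simp: G_def y_def\<close>)
      also have "\<dots> = integral {0..t} (\<lambda>s. g (y s, Q n s)) - integral {0..t} h'"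
        by (rule integral_diff) (use t in \<open>auto intro: integrable_on_subinterval[OF yint] h'int\<close>)
      also have "integral {0..t} h' = x t - x 0" using h'[OF t] by (rule integral_unique)
      finally show ?thesis using w(2)[OF t] by (simp add: y_def)
    qed
    have "steer g (y ` {0..t} \<times> V) t z (y t)" if t: "t \<in> {0..b}" for t
    proof (rule step_control_steer[OF _ Nq(1) conty Nq(2) _ yint[unfolded Q_def] sol[unfolded Q_def] t])
      show "continuous_on {0..b} (\<lambda>s. g (y s, c))" if "c \<in> V" for c
        by (rule continuous_on_compose2[OF gKV]) (use that yK in \<open>auto intro!: continuous_intros conty\<close>)
    qed (use b in auto)
    moreover have "y 0 = z" using sol[of 0] b by simp
    moreover have "dist (y s) (x s) \<le> \<delta>" if "s \<in> {0..b}" for s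
      using wd[OF that] by (simp add: y_def dist_norm)
    ultimately show "\<exists>y. continuous_on {0..b} y \<and> y 0 = z \<and>
       (\<forall>s\<in>{0..b}. dist (y s) (x s) \<le> \<delta>) \<and>
       (\<forall>t\<in>{0..b}. steer g (y ` {0..t} \<times> (U \<inter> cball 0 M)) t z (y t))"
      using conty unfolding V_def by blast
  qed
qed

section \<open>Stagewise steerability\<close>

text \<open>The level \<open>r\<close> is reached with uniformly bounded controls in uniformly bounded time, and the
  overshoot bound \<open>b R\<close> does not depend on \<open>r\<close>. No speed is prescribed: this is what makes the
  property insensitive to the rescaling of time.\<close>

definition stagewise_steerable ::
  "'a::euclidean_space set \<Rightarrow> ('a \<times> 'b::euclidean_space \<Rightarrow> 'a) \<Rightarrow> 'b set \<Rightarrow> bool" where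
  "stagewise_steerable C g U \<longleftrightarrow> (\<exists>b::real \<Rightarrow> real. (b \<longlongrightarrow> 0) (at_right 0) \<and> mono_on {0<..} b \<and>
     (\<forall>r R. 0 < r \<and> r < R \<longrightarrow> (\<exists>M \<tau>. \<forall>z. r < infdist z C \<and> infdist z C \<le> R \<longrightarrow>
        (\<exists>t z'. t \<le> \<tau> \<and> infdist z' C = r \<and>
           steer g {(x, u). r \<le> infdist x C \<and> infdist x C \<le> b R \<and> u \<in> U \<and> norm u \<le> M} t z z'))))"

section \<open>Distance levels, hitting times and descent rates\<close>

lemma bounded_infdist_le:
  fixes C :: "'a::euclidean_space set"
  assumes C: "C \<noteq> {}" "closed C" "compact (frontier C)"
  shows "bounded ({z. infdist z C \<le> R} - C)"
proof -
  obtain B where B: "\<And>w. w \<in> frontier C \<Longrightarrow> norm w \<le> B"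
    using compact_imp_bounded[OF C(3)] by (auto simp: bounded_iff)
  have "norm z \<le> B + R" if z: "z \<notin> C" "infdist z C \<le> R" for z
  proof -
    obtain y where y: "y \<in> C" "infdist z C = dist z y" using infdist_attains_inf[OF C(2,1)] by blast
    \<comment> \<open>\<open>C\<close> may be unbounded, but the segment from \<open>z\<close> to a
      nearest point of \<open>C\<close> crosses the compact boundary, which puts \<open>z\<close>
      within \<open>R\<close> of it.\<close>
    have "closed_segment z y \<inter> frontier C \<noteq> {}"
      by (rule connected_Int_frontier) (use y z in auto)
    then obtain w where w: "w \<in> closed_segment z y" "w \<in> frontier C" by blast
    have "norm (w - z) \<le> norm (y - z)" using w(1) by (rule segment_bound1)
    then have "norm (z - w) \<le> R" using y z by (simp add: dist_norm norm_minus_commute)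
    then show ?thesis using B[OF w(2)] norm_triangle_sub[of z w] by linarith
  qed
  then show ?thesis by (auto simp: bounded_iff)
qed

lemma compact_annulus:
  fixes C :: "'a::euclidean_space set"
  assumes C: "C \<noteq> {}" "closed C" "compact (frontier C)" and "0 < r"
  shows "compact {z. r \<le> infdist z C \<and> infdist z C \<le> R}"
proof (rule compact_eq_bounded_closed[THEN iffD2], intro conjI)
  show "closed {z. r \<le> infdist z C \<and> infdist z C \<le> R}"
    by (intro closed_Collect_conj closed_Collect_le continuous_intros)
  show "bounded {z. r \<le> infdist z C \<and> infdist z C \<le> R}"
    by (rule bounded_subset[OF bounded_infdist_le[OF C, of R]]) (use \<open>0 < r\<close> in auto)
qed

lemma first_hitting_time:
  fixes \<phi> :: "real \<Rightarrow> real"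
  assumes "0 \<le> b" and cont: "continuous_on {0..b} \<phi>" and "r < \<phi> 0" "\<phi> b \<le> r"
  obtains t where "t \<in> {0..b}" "\<phi> t = r" "\<And>s. s \<in> {0..t} \<Longrightarrow> r \<le> \<phi> s"
proof -
  define S where "S = {s \<in> {0..b}. \<phi> s \<le> r}"
  have "S = {0..b} \<inter> \<phi> -` {..r}" by (auto simp: S_def)
  then have "compact S"
    using continuous_closed_preimage[OF cont, of "{..r}"]
    by (simp add: compact_eq_bounded_closed bounded_Int)
  moreover have "b \<in> S" using assms by (auto simp: S_def)
  ultimately obtain t where t: "t \<in> S" "\<And>s. s \<in> S \<Longrightarrow> t \<le> s"
    using compact_attains_inf[of S] by blast
  \<comment> \<open>The minimal time only satisfies \<open>\<phi> t \<le> r\<close>. The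
    intermediate value theorem gives equality at some time up to \<open>t\<close>, and minimality
    identifies the two.\<close>
  obtain s where s: "0 \<le> s" "s \<le> t" "\<phi> s = r"
  proof -
    have "continuous_on {0..t} \<phi>" using cont by (rule continuous_on_subset) (use t in \<open>auto simp: S_def\<close>)
    then show thesis using IVT2'[of \<phi> t r 0] t assms that by (auto simp: S_def)
  qed
  then have st: "s = t" using t by (force simp: S_def)
  show thesis
  proof
    show "t \<in> {0..b}" "\<phi> t = r" using t s st by (auto simp: S_def)
    show "r \<le> \<phi> s'" if "s' \<in> {0..t}" for s'
      using t(2)[of s'] t(1) that s st by (cases "\<phi> s' \<le> r") (auto simp: S_def)
  qed
qed

lemma KL_D:
  assumes "\<beta> \<in> KL"
  shows "\<And>r s t. 0 < r \<Longrightarrow> 0 \<le> s \<Longrightarrow> s \<le> t \<Longrightarrow> \<beta> r t \<le> \<beta> r s"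
    and "\<And>r r' t. 0 \<le> r \<Longrightarrow> r \<le> r' \<Longrightarrow> 0 \<le> t \<Longrightarrow> \<beta> r t \<le> \<beta> r' t"
    and "\<And>r. 0 \<le> r \<Longrightarrow> (\<beta> r \<longlongrightarrow> 0) at_top"
    and "((\<lambda>r. \<beta> r 0) \<longlongrightarrow> 0) (at_right 0)"
proof -
  have sa: "\<And>r. r > 0 \<Longrightarrow> strict_antimono_on {0..} (\<beta> r)"
    and sm: "\<And>t. t \<ge> 0 \<Longrightarrow> strict_mono_on {0..} (\<lambda>r. \<beta> r t)"
    and z: "\<And>t. t \<ge> 0 \<Longrightarrow> \<beta> 0 t = 0"
    and lim: "\<And>r. 0 \<le> r \<Longrightarrow> (\<beta> r \<longlongrightarrow> 0) at_top"
    and cont: "continuous_on ({0..} \<times> {0..}) (\<lambda>(r, t). \<beta> r t)"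
    using assms by (auto simp: KL_def)
  show "\<beta> r t \<le> \<beta> r s" if "0 < r" "0 \<le> s" "s \<le> t" for r s t
    using monotone_onD[OF sa[OF that(1)], of s t] that by (cases "s = t") auto
  show "\<beta> r t \<le> \<beta> r' t" if "0 \<le> r" "r \<le> r'" "0 \<le> t" for r r' t
    using monotone_onD[OF sm[OF that(3)], of r r'] that by (cases "r = r'") auto
  show "\<And>r. 0 \<le> r \<Longrightarrow> (\<beta> r \<longlongrightarrow> 0) at_top" by (rule lim)
  have "continuous_on {0..} (\<lambda>r. case (r, 0) of (r, t) \<Rightarrow> \<beta> r t)"
    by (rule continuous_on_compose2[OF cont]) (auto intro!: continuous_intros)
  then have "continuous_on {0..} (\<lambda>r. \<beta> r 0)" by simp
  then have "((\<lambda>r. \<beta> r 0) \<longlongrightarrow> \<beta> 0 0) (at 0 within {0..})"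
    by (simp add: continuous_on_def)
  then show "((\<lambda>r. \<beta> r 0) \<longlongrightarrow> 0) (at_right 0)"
    using z[of 0] by (auto elim!: tendsto_within_subset)
qed

text \<open>From \<open>T\<close> on, the values of \<open>x\<close> are not governed by the system.
  If \<open>\<tau>\<close> lies there, the distance tends to 0 as \<open>T\<close> is approached
  from the left, so the level is undercut at an earlier time inside the domain.\<close>

lemma admissible_pair_reaches:
  assumes adm: "admissible_pair C g U T x u" and "0 < \<tau>" "infdist (x \<tau>) C < r" "0 < r"
  obtains b where "0 < b" "ereal b < T" "b \<le> \<tau>" "infdist (x b) C < r"
proof (cases "ereal \<tau> < T")
  case True
  then show thesis using that assms by blast
next
  case False
  have "0 < T" using adm by (simp add: admissible_pair_def)
  then obtain c where c: "T = ereal c" using False by (cases T) auto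
  then have "((\<lambda>t. infdist (x t) C) \<longlongrightarrow> 0) (at_left c)"
    using adm by (simp add: admissible_pair_def)
  then have "eventually (\<lambda>t. infdist (x t) C < r) (at_left c)"
    using \<open>0 < r\<close> by (rule order_tendstoD)
  moreover have "eventually (\<lambda>t. t \<in> {0<..<c}) (at_left c)"
    using \<open>0 < T\<close> c by (intro eventually_at_left_real) simp
  ultimately have "eventually (\<lambda>t. infdist (x t) C < r \<and> t \<in> {0<..<c}) (at_left c)"
    by (rule eventually_conj)
  then obtain t where "infdist (x t) C < r" "t \<in> {0<..<c}"
    using eventually_happens'[OF trivial_limit_at_left_real] by blast
  then show thesis using that[of t] False c by auto
qed

section \<open>From asymptotic controllability to stagewise steerability\<close>

lemma GAC_imp_stagewise_steerable:
  fixes g :: "'a::euclidean_space \<times> 'b::euclidean_space \<Rightarrow> 'a"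
  assumes C: "C \<noteq> {}" "closed C" "compact (frontier C)"
    and U: "closed U" and g: "continuous_on ((- C) \<times> U) g"
    and lip: "\<And>K U1. compact K \<Longrightarrow> K \<subseteq> - C \<Longrightarrow> compact U1 \<Longrightarrow> U1 \<subseteq> U \<Longrightarrow>
              \<exists>L>0. \<forall>x\<in>K. \<forall>y\<in>K. \<forall>u\<in>U1. norm (g (x, u) - g (y, u)) \<le> L * norm (x - y)"
    and GAC: "GAC C g U"
  shows "stagewise_steerable C g U"
proof -
  obtain \<beta> where \<beta>: "\<beta> \<in> KL" and sol: "\<And>z. z \<notin> C \<Longrightarrow>
        \<exists>T x u. admissible_pair C g U T x u \<and> x 0 = z \<and>
           (\<forall>t\<ge>0. infdist (x t) C \<le> \<beta> (infdist z C) t)"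
    using GAC unfolding GAC_def by metis
  \<comment> \<open>\<open>\<beta> R 0\<close> bounds the given trajectories, and the summand
    \<open>R\<close> pays for the tube around them.\<close>
  define b where "b = (\<lambda>R. \<beta> R 0 + R)"
  let ?W = "\<lambda>r R M. {(x, u). r \<le> infdist x C \<and> infdist x C \<le> b R \<and> u \<in> U \<and> norm u \<le> M}"
  have "((\<lambda>R::real. R) \<longlongrightarrow> 0) (at_right 0)" by (rule tendsto_ident_at)
  then have "(b \<longlongrightarrow> 0 + 0) (at_right 0)"
    unfolding b_def using KL_D(4)[OF \<beta>] by (intro tendsto_add)
  then have b_lim: "(b \<longlongrightarrow> 0) (at_right 0)" by simp
  have b_mono: "mono_on {0<..} b"
    unfolding b_def by (intro mono_onI add_mono KL_D(2)[OF \<beta>]) auto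
  have "\<exists>M \<tau>. \<forall>z. r < infdist z C \<and> infdist z C \<le> R \<longrightarrow>
        (\<exists>t z'. t \<le> \<tau> \<and> infdist z' C = r \<and> steer g (?W r R M) t z z')"
    if rR: "0 < r" "r < R" for r R
  proof -
    \<comment> \<open>A single \<open>\<tau>\<close> serves the whole annulus, since
      \<open>\<beta>\<close> increases in its first argument.\<close>
    have "eventually (\<lambda>t. \<beta> R t < r \<and> 0 < t) at_top"
      using order_tendstoD(2)[OF KL_D(3)[OF \<beta>, of R]] rR eventually_gt_at_top[of 0]
      by (auto intro: eventually_conj)
    then obtain \<tau> where \<tau>: "\<beta> R \<tau> < r" "0 < \<tau>" by (auto simp: eventually_at_top_linorder)
    \<comment> \<open>The level \<open>r\<close> is included to make the annulus compact, but only
      states strictly above it have to be steered.\<close>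
    define A where "A = {z. r \<le> infdist z C \<and> infdist z C \<le> R}"
    have A: "compact A" unfolding A_def by (rule compact_annulus[OF C rR(1)])
    define Q where "Q = (\<lambda>M z'. \<exists>t z''. t \<le> \<tau> \<and> infdist z'' C = r \<and> steer g (?W r R M) t z' z'')"
    have "\<exists>M \<rho>. 0 < \<rho> \<and> (\<forall>z'\<in>ball z \<rho>. r < infdist z' C \<longrightarrow> Q M z')" if "z \<in> A" for z
    proof -
      have z: "r \<le> infdist z C" "infdist z C \<le> R" "z \<notin> C" using that rR by (auto simp: A_def)
      obtain T x u where adm: "admissible_pair C g U T x u" and x0: "x 0 = z"
        and dec: "\<And>t. t \<ge> 0 \<Longrightarrow> infdist (x t) C \<le> \<beta> (infdist z C) t"
        using sol[OF z(3)] by blast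
      have dec': "infdist (x t) C \<le> \<beta> R t" if "0 \<le> t" for t
        using dec[OF that] KL_D(2)[OF \<beta> _ z(2) that] infdist_nonneg[of z C] by linarith
      have "infdist (x \<tau>) C < r" using dec'[of \<tau>] \<tau> by simp
      from admissible_pair_reaches[OF adm \<tau>(2) this rR(1)]
      obtain c where c: "0 < c" "ereal c < T" "c \<le> \<tau>" "infdist (x c) C < r" .
      have sub: "{0..c} \<subseteq> time_dom T" by (rule Icc_subset_time_dom[OF c(2)])
      have "abs_continuous_on {0..c} x"
        using adm sub unfolding admissible_pair_def locally_abs_continuous_on_def by blast
      then have cont: "continuous_on {0..c} (\<lambda>s. infdist (x s) C)"
        by (intro continuous_on_infdist abs_continuous_on_imp_continuous_on)
      have "{0..c} \<noteq> {}" using c by simp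
      from continuous_attains_inf[OF compact_Icc this cont]
      obtain s0 where s0: "s0 \<in> {0..c}" "\<And>s. s \<in> {0..c} \<Longrightarrow> infdist (x s0) C \<le> infdist (x s) C"
        by blast
      have "x s0 \<notin> C" using adm sub s0(1) unfolding admissible_pair_def by blast
      then have pos: "0 < infdist (x s0) C" using C by (intro infdist_pos_not_in_closed)
      \<comment> \<open>Three demands on the tube: it avoids \<open>C\<close>, its end lies at or
        below the level \<open>r\<close>, and it adds at most \<open>R\<close> to the
        overshoot.\<close>
      define \<delta> where "\<delta> = min (infdist (x s0) C / 2) (min ((r - infdist (x c) C) / 2) R)"
      have \<delta>: "0 < \<delta>" "\<delta> \<le> infdist (x s0) C / 2" "\<delta> \<le> (r - infdist (x c) C) / 2" "\<delta> \<le> R"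
        using pos c rR by (auto simp: \<delta>_def min_def field_simps)
      have tube: "cball (x s) \<delta> \<subseteq> - C" if "s \<in> {0..c}" for s
      proof
        fix p assume "p \<in> cball (x s) \<delta>"
        then have "infdist (x s) C \<le> infdist p C + \<delta>"
          using infdist_triangle[of "x s" C p] by simp
        then have "0 < infdist p C" using \<delta>(2) s0(2)[OF that] pos by linarith
        then show "p \<in> - C" by auto
      qed
      obtain M \<rho> where \<rho>: "0 < \<rho>" and per: "\<And>z'. z' \<in> ball (x 0) \<rho> \<Longrightarrow> \<exists>y. continuous_on {0..c} y \<and> y 0 = z' \<and>
         (\<forall>s\<in>{0..c}. dist (y s) (x s) \<le> \<delta>) \<and>
         (\<forall>t\<in>{0..c}. steer g (y ` {0..t} \<times> (U \<inter> cball 0 M)) t z' (y t))"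
        by (rule perturbed_steering[OF U g _ adm c(1,2) \<delta>(1)]) (erule (3) lip, erule tube, blast intro: that)
      have "Q M z'" if z': "z' \<in> ball z \<rho>" "r < infdist z' C" for z'
      proof -
        obtain y where y: "continuous_on {0..c} y" "y 0 = z'" "\<And>s. s\<in>{0..c} \<Longrightarrow> dist (y s) (x s) \<le> \<delta>"
          "\<And>t. t\<in>{0..c} \<Longrightarrow> steer g (y ` {0..t} \<times> (U \<inter> cball 0 M)) t z' (y t)"
          using per[of z'] z' x0 by blast
        have near: "infdist (y s) C \<le> infdist (x s) C + \<delta>" if "s \<in> {0..c}" for s
          using infdist_triangle[of "y s" C "x s"] y(3)[OF that] by linarith
        have "infdist (y c) C \<le> r" using near[of c] \<delta>(3) c by (simp add: field_simps)
        then obtain t where t: "t \<in> {0..c}" "infdist (y t) C = r" "\<And>s. s \<in> {0..t} \<Longrightarrow> r \<le> infdist (y s) C"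
          using first_hitting_time[of c "\<lambda>s. infdist (y s) C" r] y(1,2) z'(2) c(1)
          by (metis continuous_on_infdist less_imp_le)
        have "y ` {0..t} \<times> (U \<inter> cball 0 M) \<subseteq> ?W r R M"
        proof -
          have "infdist (y s) C \<le> b R" if s: "s \<in> {0..t}" for s
          proof -
            have "s \<in> {0..c}" using s t(1) by auto
            then show ?thesis
              using near[of s] dec'[of s] KL_D(1)[OF \<beta>, of R 0 s] \<delta>(4) rR by (simp add: b_def)
          qed
          then show ?thesis using t(3) by auto
        qed
        then have "steer g (?W r R M) t z' (y t)" by (rule steer_mono[OF y(4)[OF t(1)]])
        moreover have "t \<le> \<tau>" using t(1) c(3) by simp
        ultimately show ?thesis using t(2) unfolding Q_def by blast
      qed
      then show ?thesis using \<rho> by blast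
    qed
    then obtain M \<rho> where \<rho>: "\<And>z. z \<in> A \<Longrightarrow> 0 < \<rho> z" and st: "\<And>z z'. z \<in> A \<Longrightarrow> z' \<in> ball z (\<rho> z) \<Longrightarrow>
         r < infdist z' C \<Longrightarrow> Q (M z) z'"
      by metis
    obtain D where D: "D \<subseteq> A" "finite D" "A \<subseteq> (\<Union>z\<in>D. ball z (\<rho> z))"
      by (rule compactE_image[OF A, of A "\<lambda>z. ball z (\<rho> z)"]) (use \<rho> in auto)
    define M0 where "M0 = Max (M ` D)"
    have "\<exists>t z''. t \<le> \<tau> \<and> infdist z'' C = r \<and> steer g (?W r R M0) t z z''"
      if "r < infdist z C" "infdist z C \<le> R" for z
    proof -
      have "z \<in> A" using that by (simp add: A_def)
      then obtain w where w: "w \<in> D" "z \<in> ball w (\<rho> w)" using D by blast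
      have "M w \<le> M0" unfolding M0_def using D(2) w(1) by simp
      then have "?W r R (M w) \<subseteq> ?W r R M0" by auto
      moreover have "Q (M w) z" using st[of w z] w D(1) that(1) by blast
      ultimately show ?thesis unfolding Q_def using steer_mono[of g "?W r R (M w)" _ _ _ "?W r R M0"] by blast
    qed
    then show ?thesis by blast
  qed
  then show ?thesis using b_lim b_mono unfolding stagewise_steerable_def by blast
qed

text \<open>On controls of norm at most \<open>M\<close> the slowdown \<open>1 / \<rho>\<close> has
  a bound \<open>m\<close>, which only replaces \<open>\<tau>\<close> by \<open>m * \<tau>\<close>;
  the overshoot and \<open>M\<close> stay. The factor is abstract so that it covers both directions
  between the systems.\<close>

lemma stagewise_steerable_time_change:
  assumes S: "stagewise_steerable C g U"
    and scale: "\<And>x u. x \<notin> C \<Longrightarrow> u \<in> U \<Longrightarrow> g' (x, u) = \<rho> (norm u) *\<^sub>R g (x, u)"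
    and \<rho>: "\<And>s. 0 \<le> s \<Longrightarrow> 0 < \<rho> s" and anti: "\<And>M. \<exists>m\<ge>0. \<forall>s\<in>{0..M}. 1 / \<rho> s \<le> m"
  shows "stagewise_steerable C g' U"
proof -
  obtain b where b: "(b \<longlongrightarrow> 0) (at_right 0)" "mono_on {0<..} b"
    and st: "\<And>r R. 0 < r \<Longrightarrow> r < R \<Longrightarrow> \<exists>M \<tau>. \<forall>z. r < infdist z C \<and> infdist z C \<le> R \<longrightarrow>
        (\<exists>t z'. t \<le> \<tau> \<and> infdist z' C = r \<and>
           steer g {(x, u). r \<le> infdist x C \<and> infdist x C \<le> b R \<and> u \<in> U \<and> norm u \<le> M} t z z')"
    using S unfolding stagewise_steerable_def by blast
  have "\<exists>M \<tau>. \<forall>z. r < infdist z C \<and> infdist z C \<le> R \<longrightarrow>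
        (\<exists>t z'. t \<le> \<tau> \<and> infdist z' C = r \<and>
           steer g' {(x, u). r \<le> infdist x C \<and> infdist x C \<le> b R \<and> u \<in> U \<and> norm u \<le> M} t z z')"
    if rR: "0 < r" "r < R" for r R
  proof -
    obtain M \<tau> where M: "\<And>z. r < infdist z C \<Longrightarrow> infdist z C \<le> R \<Longrightarrow>
        (\<exists>t z'. t \<le> \<tau> \<and> infdist z' C = r \<and>
           steer g {(x, u). r \<le> infdist x C \<and> infdist x C \<le> b R \<and> u \<in> U \<and> norm u \<le> M} t z z')"
      using st[OF rR] by blast
    obtain m where m: "m \<ge> 0" "\<And>s. s \<in> {0..M} \<Longrightarrow> 1 / \<rho> s \<le> m" using anti[of M] by blast
    have "\<exists>t' z'. t' \<le> m * \<tau> \<and> infdist z' C = r \<and>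
           steer g' {(x, u). r \<le> infdist x C \<and> infdist x C \<le> b R \<and> u \<in> U \<and> norm u \<le> M} t' z z'"
      if z: "r < infdist z C" "infdist z C \<le> R" for z
    proof -
      obtain t z' where t: "t \<le> \<tau>" "infdist z' C = r"
        "steer g {(x, u). r \<le> infdist x C \<and> infdist x C \<le> b R \<and> u \<in> U \<and> norm u \<le> M} t z z'"
        using M[OF z] by blast
      have "\<exists>t'\<le>m * t. steer g' {(x, u). r \<le> infdist x C \<and> infdist x C \<le> b R \<and> u \<in> U \<and> norm u \<le> M} t' z z'"
      proof (rule steer_time_change[OF t(3), where \<rho> = "\<lambda>u. \<rho> (norm u)"])
        fix x u assume a: "(x, u) \<in> {(x, u). r \<le> infdist x C \<and> infdist x C \<le> b R \<and> u \<in> U \<and> norm u \<le> M}"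
        then have "x \<notin> C" using rR by auto
        then show "g' (x, u) = \<rho> (norm u) *\<^sub>R g (x, u) \<and> 0 < \<rho> (norm u) \<and> 1 / \<rho> (norm u) \<le> m"
          using a scale \<rho> m(2) by auto
      qed
      moreover have "m * t \<le> m * \<tau>" using t(1) m(1) by (rule mult_left_mono)
      ultimately show ?thesis using t(2) order_trans by blast
    qed
    then show ?thesis by blast
  qed
  then show ?thesis using b unfolding stagewise_steerable_def by blast
qed

section \<open>Descent rates and control bounds\<close>

text \<open>The average over \<open>{s..s+1}\<close> lies between the values of a monotone
  \<open>\<phi>\<close> at the two ends, and it is continuous as a difference of values of an
  indefinite integral. The upper estimate passes a limit of \<open>\<phi>\<close> at minus infinity
  on to \<open>H\<close>.\<close>

lemma mono_continuous_majorant: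
  fixes \<phi> :: "real \<Rightarrow> real"
  assumes "mono \<phi>"
  obtains H where "continuous_on UNIV H" "mono H" "\<And>s. \<phi> s \<le> H s" "\<And>s. H s \<le> \<phi> (s + 1)"
proof
  define H where "H = (\<lambda>s. integral {s..s+1} \<phi>)"
  have int: "\<phi> integrable_on {a..b}" for a b
    by (rule integrable_on_mono_on) (use assms in \<open>auto intro: mono_on_subset\<close>)
  have shift: "H s = integral {0..1} (\<lambda>r. \<phi> (s + r))" "(\<lambda>r. \<phi> (s + r)) integrable_on {0..1}" for s
  proof -
    have m: "mono (\<lambda>r. \<phi> (s + r))" using assms by (simp add: mono_def)
    show "(\<lambda>r. \<phi> (s + r)) integrable_on {0..1}"
      by (rule integrable_on_mono_on) (use m in \<open>auto intro: mono_on_subset\<close>)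
    show "H s = integral {0..1} (\<lambda>r. \<phi> (s + r))"
      unfolding H_def using integral_shift_Icc_real[of 0 1 \<phi> s] by (simp add: add.commute o_def)
  qed
  show "mono H"
    unfolding shift(1) using assms shift(2) by (intro monoI integral_le) (auto simp: shift(1) mono_def intro!: integral_le)
  have "integral {s..s+1} (\<lambda>_. \<phi> s) \<le> H s" for s
    unfolding H_def by (rule integral_le) (use assms int in \<open>auto simp: mono_def\<close>)
  then show "\<phi> s \<le> H s" for s by simp
  have "H s \<le> integral {s..s+1} (\<lambda>_. \<phi> (s + 1))" for s
    unfolding H_def by (rule integral_le) (use assms int in \<open>auto simp: mono_def\<close>)
  then show "H s \<le> \<phi> (s + 1)" for s by simp
  have "isCont H s" for s
  proof -
    define I where "I = (\<lambda>t. integral {s-1..t} \<phi>)"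
    have "continuous_on {s-1..s+3} I"
      unfolding I_def using int by (rule indefinite_integral_continuous_1)
    then have I: "isCont I t" if "t \<in> {s-1<..<s+3}" for t
      using that by (intro continuous_on_interior[of "{s-1..s+3}"]) (auto simp: interior_atLeastAtMost_real)
    have "isCont (\<lambda>t. I (t + 1)) s"
      by (rule isCont_o2[of s "\<lambda>t. t + 1" I]) (auto intro: I)
    then have "isCont (\<lambda>t. I (t + 1) - I t) s"
      by (rule continuous_diff) (rule I, simp)
    moreover have "eventually (\<lambda>t. I (t + 1) - I t = H t) (nhds s)"
    proof (rule eventually_nhds_in_open[of "{s-1<..<s+2}" s, THEN eventually_mono])
      fix t assume "t \<in> {s-1<..<s+2}"
      then show "I (t + 1) - I t = H t"
        using Henstock_Kurzweil_Integration.integral_combine[of "s-1" t "t+1" \<phi>] int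
        by (auto simp: I_def H_def)
    qed auto
    ultimately show ?thesis by (simp add: isCont_cong)
  qed
  then show "continuous_on UNIV H" by (simp add: continuous_on_eq_continuous_at)
qed

text \<open>\<open>M k\<close> may grow as \<open>k\<close> tends to either infinity. Measuring a
  distance by \<open>\<bar>ln r\<bar>\<close> folds both ends into one, so that a single monotone
  majorant suffices.\<close>

lemma continuous_control_bound:
  fixes M B :: "int \<Rightarrow> real"
  assumes B: "mono B" "\<And>e. 0 < e \<Longrightarrow> \<exists>k. B k < e"
  obtains \<sigma> where "continuous_on {0<..} \<sigma>" "\<And>r. 0 < r \<Longrightarrow> 0 < \<sigma> r"
    "\<And>k r. exp (real_of_int k - 1) \<le> r \<Longrightarrow> r \<le> B k \<Longrightarrow> M k \<le> \<sigma> r"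
proof -
  \<comment> \<open>The stages that can visit a distance between \<open>exp (- s)\<close> and
    \<open>exp s\<close>. The first condition bounds \<open>k\<close> from above, the second from
    below because \<open>B\<close> becomes arbitrarily small.\<close>
  define S where "S = (\<lambda>s. {k. exp (real_of_int k - 1) \<le> exp s \<and> exp (- s) \<le> B k})"
  have finS: "finite (S s)" for s
  proof -
    obtain k0 where k0: "B k0 < exp (- s)" using B(2)[of "exp (- s)"] by auto
    have "S s \<subseteq> {k0..\<lceil>s + 1\<rceil>}"
    proof
      fix k assume k: "k \<in> S s"
      then have "k0 \<le> k" using k0 monoD[OF B(1), of k k0] by (force simp: S_def)
      then show "k \<in> {k0..\<lceil>s + 1\<rceil>}" using k by (auto simp: S_def) linarith
    qed
    then show ?thesis by (rule finite_subset) simp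
  qed
  \<comment> \<open>The element 1 makes the set nonempty and the bound positive.\<close>
  define \<phi> where "\<phi> = (\<lambda>s. Max (insert 1 (M ` S s)))"
  have "mono \<phi>"
  proof (rule monoI)
    fix s t :: real assume "s \<le> t"
    then have "exp s \<le> exp t" "exp (- t) \<le> exp (- s)" by auto
    then have "S s \<subseteq> S t" unfolding S_def using order_trans by blast
    then show "\<phi> s \<le> \<phi> t" unfolding \<phi>_def using finS by (intro Max_mono) auto
  qed
  then obtain H where H: "continuous_on UNIV H" "\<And>s. \<phi> s \<le> H s"
    by (rule mono_continuous_majorant) blast
  show thesis
  proof
    show "continuous_on {0<..} (\<lambda>r. H \<bar>ln r\<bar>)"
      by (intro continuous_on_compose2[OF H(1)] continuous_intros) auto
    have "1 \<le> \<phi> s" for s unfolding \<phi>_def using finS by simp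
    then show "0 < H \<bar>ln r\<bar>" for r using H(2)[of "\<bar>ln r\<bar>"] by (meson less_le_trans zero_less_one)
    fix k r assume kr: "exp (real_of_int k - 1) \<le> r" "r \<le> B k"
    then have r: "0 < r" using exp_gt_zero[of "real_of_int k - 1"] by linarith
    have "r \<le> exp \<bar>ln r\<bar>" "exp (- \<bar>ln r\<bar>) \<le> r"
      using r exp_le_cancel_iff[of "ln r" "\<bar>ln r\<bar>"] exp_le_cancel_iff[of "- \<bar>ln r\<bar>" "ln r"] by simp_all
    then have "exp (real_of_int k - 1) \<le> exp \<bar>ln r\<bar>" "exp (- \<bar>ln r\<bar>) \<le> B k"
      using kr by linarith+
    then have "k \<in> S \<bar>ln r\<bar>" unfolding S_def by blast
    then have "M k \<le> \<phi> \<bar>ln r\<bar>" unfolding \<phi>_def using finS by simp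
    then show "M k \<le> H \<bar>ln r\<bar>" using H(2) order_trans by blast
  qed
qed

text \<open>In the coordinates given by \<open>G\<close> and \<open>h\<close>, decay is a
  translation in time. The value 0 at \<open>r = 0\<close> fits continuously, uniformly in
  \<open>t\<close>, because \<open>h (G r - t) \<le> h (G r)\<close>. The lower bound
  \<open>exp\<close> makes \<open>h\<close> positive and gives unboundedness in
  \<open>r\<close>.\<close>

lemma KL_shiftI:
  fixes h G :: "real \<Rightarrow> real"
  assumes h: "continuous_on UNIV h" "strict_mono h" "(h \<longlongrightarrow> 0) at_bot" "\<And>s. exp s \<le> h s"
    and G: "continuous_on {0<..} G" "strict_mono_on {0<..} G" "filterlim G at_bot (at_right 0)"
      "filterlim G at_top at_top"
  shows "(\<lambda>r t. if r \<le> 0 then 0 else h (G r - t)) \<in> KL" (is "?\<beta> \<in> KL")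
proof -
  have hpos: "0 < h s" for s using h(4)[of s] exp_gt_zero[of s] by linarith
  have hmono: "h s < h t \<longleftrightarrow> s < t" "h s \<le> h t \<longleftrightarrow> s \<le> t" for s t
    using h(2) by (simp_all add: strict_mono_less strict_mono_less_eq)
  have cont: "continuous_on ({0..} \<times> {0..}) (\<lambda>(r, t). ?\<beta> r t)"
    unfolding continuous_on_eq_continuous_within
  proof
    fix p :: "real \<times> real" assume p: "p \<in> {0..} \<times> {0..}"
    show "continuous (at p within {0..} \<times> {0..}) (\<lambda>(r, t). ?\<beta> r t)"
    proof (cases "0 < fst p")
      case True
      have "continuous_on ({0<..} \<times> UNIV) (\<lambda>p. h (G (fst p) - snd p))"
        by (intro continuous_on_compose2[OF h(1)] continuous_intros continuous_on_compose2[OF G(1)]) auto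
      then have "isCont (\<lambda>p. h (G (fst p) - snd p)) p"
        using True by (cases p) (simp add: continuous_on_eq_continuous_at open_Times)
      moreover have "eventually (\<lambda>p. h (G (fst p) - snd p) = (\<lambda>(r, t). ?\<beta> r t) p) (nhds p)"
        using True
        by (intro eventually_nhds_in_open[of "{0<..} \<times> UNIV" p, THEN eventually_mono])
           (auto simp: open_Times mem_Times_iff)
      ultimately have "isCont (\<lambda>(r, t). ?\<beta> r t) p" by (simp add: isCont_cong)
      then show ?thesis by (rule continuous_at_imp_continuous_at_within)
    next
      case False
      then have p0: "fst p = 0" using p by (auto simp: mem_Times_iff)
      show ?thesis unfolding continuous_within_eps_delta
      proof (intro allI impI)
        fix e :: real assume "0 < e"
        have "((\<lambda>r. h (G r)) \<longlongrightarrow> 0) (at_right 0)"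
          by (rule filterlim_compose[OF h(3) G(3)])
        then have "eventually (\<lambda>r. h (G r) < e) (at_right 0)"
          using \<open>0 < e\<close> by (rule order_tendstoD)
        then obtain d where d: "d > 0" "\<And>r. 0 < r \<Longrightarrow> r < d \<Longrightarrow> h (G r) < e"
          by (auto simp: eventually_at_right_field)
        show "\<exists>d>0. \<forall>q\<in>{0..} \<times> {0..}. dist q p < d \<longrightarrow>
            dist ((\<lambda>(r, t). ?\<beta> r t) q) ((\<lambda>(r, t). ?\<beta> r t) p) < e"
        proof (intro exI conjI ballI impI)
          fix q assume q: "q \<in> {0..} \<times> {0..}" "dist q p < d"
          have "dist (fst q) (fst p) < d" using dist_fst_le[of q p] q(2) by linarith
          then have "fst q < d" using p0 by (simp add: dist_real_def)
          then have "h (G (fst q)) < e" if "0 < fst q" using d(2) that by blast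
          moreover have "h (G (fst q) - snd q) \<le> h (G (fst q))" using q(1) by (auto simp: hmono)
          ultimately show "dist ((\<lambda>(r, t). ?\<beta> r t) q) ((\<lambda>(r, t). ?\<beta> r t) p) < e"
            using p0 \<open>0 < e\<close> hpos[of "G (fst q) - snd q"] by (auto simp: dist_real_def split_def)
        qed fact
      qed
    qed
  qed
  have sm: "strict_mono_on {0..} (\<lambda>r. ?\<beta> r t)" for t
    by (rule strict_mono_onI) (auto simp: hmono hpos intro: strict_mono_onD[OF G(2)])
  have unb: "\<not> bdd_above ((\<lambda>r. ?\<beta> r t) ` {0..})" for t
  proof
    assume "bdd_above ((\<lambda>r. ?\<beta> r t) ` {0..})"
    then obtain Z where Z: "\<And>r. r \<in> {0..} \<Longrightarrow> ?\<beta> r t \<le> Z"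
      unfolding bdd_above_def by blast
    have "eventually (\<lambda>r. ln (\<bar>Z\<bar> + 1) + t \<le> G r \<and> 0 < r) at_top"
      using G(4) eventually_gt_at_top[of 0] by (auto simp: filterlim_at_top intro: eventually_conj)
    then obtain r where r: "ln (\<bar>Z\<bar> + 1) + t \<le> G r" "0 < r" by (auto simp: eventually_at_top_linorder)
    have "\<bar>Z\<bar> + 1 = exp (ln (\<bar>Z\<bar> + 1))" by simp
    also have "\<dots> \<le> exp (G r - t)"
      unfolding exp_le_cancel_iff using r(1) by linarith
    also have "\<dots> \<le> ?\<beta> r t" using r(2) h(4) by simp
    also have "\<dots> \<le> Z" using Z[of r] r(2) by simp
    finally show False by linarith
  qed
  have sa: "strict_antimono_on {0..} (?\<beta> r)" if "0 < r" for r
    using that by (auto simp: monotone_on_def hmono)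
  have lim: "(?\<beta> r \<longlongrightarrow> 0) at_top" for r
  proof (cases "r \<le> 0")
    case False
    have "filterlim (\<lambda>t. G r - t) at_bot at_top"
      using filterlim_tendsto_add_at_bot_iff[OF tendsto_const[of "G r"], of "\<lambda>t. - t"]
        filterlim_uminus_at_bot_at_top by simp
    from filterlim_compose[OF h(3) this] show ?thesis using False by simp
  qed simp
  show ?thesis
    unfolding KL_def
  proof (intro CollectI conjI allI impI)
    show "0 \<le> ?\<beta> r t" for r t using hpos[THEN less_imp_le] by simp
  qed (rule cont, simp, rule sm, rule unb, erule sa, rule lim)
qed

text \<open>A trajectory that spends time at most \<open>\<theta> k - \<theta> (k - 1)\<close> at the \<open>k\<close>-th level loses one unit of
  the potential \<open>\<theta>\<close> per unit of time, which leads to the descent rate \<open>h (G r - t)\<close>.\<close>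

lemma KL_level_bound:
  fixes \<theta> B :: "int \<Rightarrow> real"
  assumes \<theta>: "\<And>k. \<theta> (k - 1) + 1 \<le> \<theta> k"
    and B: "mono B" "\<And>e. 0 < e \<Longrightarrow> \<exists>k. B k < e" "\<And>k. 0 \<le> B k"
  obtains \<beta> where "\<beta> \<in> KL"
    "\<And>r s j. 0 < r \<Longrightarrow> s < \<theta> \<lceil>ln r\<rceil> - \<theta> (j - 1) \<Longrightarrow> B j \<le> \<beta> r s"
proof -
  have growth: "\<theta> k + real_of_int (m - k) \<le> \<theta> m" if "k \<le> m" for k m
    using that
  proof (induction rule: int_ge_induct)
    case (step i)
    then show ?case using \<theta>[of "i + 1"] by simp
  qed simp
  have \<theta>mono: "\<theta> k \<le> \<theta> m" if "k \<le> m" for k m using growth[OF that] that by simp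
  have \<theta>less: "k < m" if "\<theta> k < \<theta> m" for k m using \<theta>mono[of m k] that by linarith
  \<comment> \<open>The levels not yet passed when the potential is \<open>s\<close>. Level
    \<open>j\<close> is passed only when the potential has dropped to
    \<open>\<theta> (j - 1)\<close>, hence the shift of the index. \<open>\<phi>\<close> below is
    the largest overshoot among these levels.\<close>
  define J where "J = (\<lambda>s. {j. \<theta> (j - 1) < s})"
  have Jne: "J s \<noteq> {}" for s
  proof -
    define j where "j = min 0 \<lfloor>s - \<theta> 0\<rfloor>"
    have "\<theta> (j - 1) \<le> \<theta> 0 + real_of_int (j - 1)"
    proof -
      have "j \<le> 0" by (simp add: j_def)
      then show ?thesis using growth[of "j - 1" 0] by simp
    qed
    also have "\<dots> < s" unfolding j_def by linarith
    finally show ?thesis by (auto simp: J_def)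
  qed
  have bdd: "bdd_above (B ` J s)" for s
  proof (rule bdd_aboveI2)
    fix j assume j: "j \<in> J s"
    have "j \<le> max 1 (\<lceil>s - \<theta> 0\<rceil> + 1)"
      using growth[of 0 "j - 1"] j by (cases "1 \<le> j") (auto simp: J_def, linarith)
    then show "B j \<le> B (max 1 (\<lceil>s - \<theta> 0\<rceil> + 1))" by (rule monoD[OF B(1)])
  qed
  define \<phi> where "\<phi> = (\<lambda>s. SUP j\<in>J s. B j)"
  have "mono \<phi>"
  proof (rule monoI)
    fix s t :: real assume "s \<le> t"
    then have "J s \<subseteq> J t" by (auto simp: J_def)
    then show "\<phi> s \<le> \<phi> t" unfolding \<phi>_def by (intro cSUP_subset_mono bdd Jne) auto
  qed
  then obtain H where H: "continuous_on UNIV H" "mono H" "\<And>s. \<phi> s \<le> H s" "\<And>s. H s \<le> \<phi> (s + 1)"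
    by (rule mono_continuous_majorant) blast
  have \<phi>B: "B j \<le> \<phi> s" if "\<theta> (j - 1) < s" for j s
    unfolding \<phi>_def by (rule cSUP_upper[OF _ bdd]) (use that in \<open>simp add: J_def\<close>)
  have \<phi>0: "0 \<le> \<phi> s" for s
  proof -
    obtain j where "j \<in> J s" using Jne by blast
    then show ?thesis using \<phi>B[of j s] B(3)[of j] by (simp add: J_def)
  qed
  have H0: "(H \<longlongrightarrow> 0) at_bot"
  proof (rule tendstoI)
    fix e :: real assume "0 < e"
    then obtain k where k: "B k < e" using B(2) by blast
    \<comment> \<open>Subtracting 1 compensates for the argument \<open>s + 1\<close> in the upper
      bound on \<open>H\<close>.\<close>
    have "H s < e" if "s \<le> \<theta> k - 1" for s
    proof -
      have "\<phi> (s + 1) \<le> B k"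
        unfolding \<phi>_def
      proof (rule cSUP_least[OF Jne])
        fix j assume "j \<in> J (s + 1)"
        then have "\<theta> (j - 1) < \<theta> k" using that by (simp add: J_def)
        then have "j \<le> k" using \<theta>less by fastforce
        then show "B j \<le> B k" by (rule monoD[OF B(1)])
      qed
      then show ?thesis using H(4)[of s] k by linarith
    qed
    moreover have "0 \<le> H s" for s using \<phi>0[of s] H(3)[of s] by linarith
    ultimately show "eventually (\<lambda>s. dist (H s) 0 < e) at_bot"
      unfolding eventually_at_bot_linorder by (intro exI[of _ "\<theta> k - 1"]) (auto simp: dist_real_def)
  qed
  define \<psi> where "\<psi> = (\<lambda>y::real. \<theta> \<lceil>y\<rceil>)"
  have "mono \<psi>" unfolding \<psi>_def by (intro monoI \<theta>mono ceiling_mono)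
  then obtain K where K: "continuous_on UNIV K" "mono K" "\<And>y. \<psi> y \<le> K y" "\<And>y. K y \<le> \<psi> (y + 1)"
    by (rule mono_continuous_majorant) blast
  note K_bounds = K(3,4)[unfolded \<psi>_def]
  \<comment> \<open>\<open>K (ln r)\<close> majorises the potential of the starting level. The
    summand \<open>r\<close> makes \<open>G\<close> strictly increasing, as \<open>exp s\<close>
    does for \<open>h\<close>.\<close>
  define G where "G = (\<lambda>r. K (ln r) + r)"
  define h where "h = (\<lambda>s. H s + exp s)"
  have "(\<lambda>r t. if r \<le> 0 then 0 else h (G r - t)) \<in> KL"
  proof (rule KL_shiftI)
    show "continuous_on UNIV h" unfolding h_def by (intro continuous_intros H)
    show "strict_mono h"
      unfolding h_def by (rule strict_monoI) (intro add_le_less_mono monoD[OF H(2)], auto)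
    have "((\<lambda>s::real. H s + exp s) \<longlongrightarrow> 0 + 0) at_bot" by (intro tendsto_add H0 exp_at_bot)
    then show "(h \<longlongrightarrow> 0) at_bot" by (simp add: h_def)
    show "exp s \<le> h s" for s using \<phi>0[of s] H(3)[of s] by (simp add: h_def)
    show "continuous_on {0<..} G"
      unfolding G_def by (intro continuous_intros continuous_on_compose2[OF K(1)]) auto
    show "strict_mono_on {0<..} G"
      unfolding G_def by (rule strict_mono_onI) (intro add_le_less_mono monoD[OF K(2)], auto)
    show "filterlim G at_bot (at_right 0)"
    \<comment> \<open>The constant 3 arises since \<open>\<lceil>ln r + 1\<rceil>\<close> exceeds
      \<open>ln r\<close> by at most 2 and the summand \<open>r\<close> of \<open>G r\<close> is at
      most 1.\<close>
    proof (rule filterlim_at_bot_mono[of "\<lambda>r. (\<theta> 0 + 3) + ln r"])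
      show "filterlim (\<lambda>r::real. (\<theta> 0 + 3) + ln r) at_bot (at_right 0)"
        by (subst filterlim_tendsto_add_at_bot_iff[OF tendsto_const]) (rule ln_at_0)
      have "G r \<le> (\<theta> 0 + 3) + ln r" if r: "0 < r" "r < exp (- 2)" for r
      proof -
        have "ln r < - 2" using r by (metis ln_exp ln_less_cancel_iff exp_gt_zero)
        then have "\<lceil>ln r + 1\<rceil> \<le> 0" by linarith
        then have "\<theta> \<lceil>ln r + 1\<rceil> \<le> \<theta> 0 + real_of_int \<lceil>ln r + 1\<rceil>"
          using growth[of "\<lceil>ln r + 1\<rceil>" 0] by simp
        moreover have "real_of_int \<lceil>ln r + 1\<rceil> \<le> ln r + 2" by linarith
        moreover have "r \<le> 1" using r exp_less_one_iff[of "- 2::real"] by linarith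
        ultimately show ?thesis using K_bounds(2)[of "ln r"] unfolding G_def by linarith
      qed
      then show "eventually (\<lambda>r. G r \<le> (\<theta> 0 + 3) + ln r) (at_right 0)"
        unfolding eventually_at_right_field by (intro exI[of _ "exp (- 2)"]) auto
    qed
    show "filterlim G at_top at_top"
    proof (rule filterlim_at_top_mono[of "\<lambda>r. \<theta> 0 + r"])
      show "filterlim (\<lambda>r::real. \<theta> 0 + r) at_top at_top"
        by (rule filterlim_tendsto_add_at_top[OF tendsto_const filterlim_ident])
      have "\<theta> 0 + r \<le> G r" if "1 \<le> r" for r
      proof -
        have "0 \<le> \<lceil>ln r\<rceil>" using that ln_ge_zero[of r] by linarith
        then show ?thesis using K_bounds(1)[of "ln r"] \<theta>mono[of 0 "\<lceil>ln r\<rceil>"] by (simp add: G_def)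
      qed
      then show "eventually (\<lambda>r. \<theta> 0 + r \<le> G r) at_top"
        by (auto simp: eventually_at_top_linorder)
    qed
  qed
  moreover have "B j \<le> (if r \<le> 0 then 0 else h (G r - s))"
    if "0 < r" "s < \<theta> \<lceil>ln r\<rceil> - \<theta> (j - 1)" for r s j
  proof -
    have "\<theta> (j - 1) < G r - s" using that K_bounds(1)[of "ln r"] by (simp add: G_def)
    then have "B j \<le> H (G r - s)" using \<phi>B[of j "G r - s"] H(3)[of "G r - s"] by linarith
    then have "B j \<le> h (G r - s)" using exp_ge_zero[of "G r - s"] unfolding h_def by linarith
    then show ?thesis using that by simp
  qed
  ultimately show thesis by (rule that)
qed

section \<open>Concatenation of stages\<close>

text \<open>Each stage starts where the previous one ended, hence a dependent choice of triples of
  time, curve and control. The invariant asks for a distance between two levels rather than on one,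
  because the initial state need not lie on a level.\<close>

lemma concatenate_stages:
  fixes g :: "'a::euclidean_space \<times> 'b::euclidean_space \<Rightarrow> 'a" and l :: "nat \<Rightarrow> real"
  assumes g: "continuous_on W g"
    and l: "\<And>j. l (Suc j) < l j"
    and stage: "\<And>j z. l (Suc j) < infdist z C \<Longrightarrow> infdist z C \<le> l j \<Longrightarrow>
      \<exists>t\<le>\<tau> j. \<exists>z'. infdist z' C = l (Suc j) \<and> steer g (W \<inter> {(x, u). infdist x C \<le> B j}) t z z'"
    and z: "l (Suc 0) < infdist z C" "infdist z C \<le> l 0"
  obtains t :: "nat \<Rightarrow> real" and X U where "t 0 = 0" "\<And>j. X j 0 = z" "\<And>j. traj g W (t j) (X j) (U j)"
    "\<And>j. t j < t (Suc j)" "\<And>j. t (Suc j) \<le> t j + \<tau> j"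
    "\<And>j s. s \<le> t j \<Longrightarrow> X (Suc j) s = X j s" "\<And>j s. s < t j \<Longrightarrow> U (Suc j) s = U j s"
    "\<And>j s. s \<in> {t j..<t (Suc j)} \<Longrightarrow> infdist (X (Suc j) s) C \<le> B j"
proof -
  define P where "P = (\<lambda>j (t, x, u :: real \<Rightarrow> 'b). traj g W t x u \<and> x 0 = z \<and> (j = 0 \<longrightarrow> t = 0) \<and>
    l (Suc j) < infdist (x t) C \<and> infdist (x t) C \<le> l j)"
  define Q where "Q = (\<lambda>j (t, x :: real \<Rightarrow> 'a, u :: real \<Rightarrow> 'b) (t', x', u'). t < t' \<and> t' \<le> t + \<tau> j \<and>
    (\<forall>s\<le>t. x' s = x s) \<and> (\<forall>s<t. u' s = u s) \<and> (\<forall>s\<in>{t..<t'}. infdist (x' s) C \<le> B j))"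
  have "\<exists>f. \<forall>n. P n (f n) \<and> Q n (f n) (f (Suc n))"
  proof (rule dependent_nat_choice)
    have "traj g W 0 (\<lambda>_. z) (\<lambda>_. 0)"
      unfolding traj_def by (auto intro!: exI[of _ 0] lipschitz_onI)
    then have "P 0 (0, \<lambda>_. z, \<lambda>_. 0)" using z by (simp add: P_def)
    then show "\<exists>p. P 0 p" by blast
  next
    fix p n assume Pp: "P n p"
    obtain t x u where p: "p = (t, x, u)" by (cases p)
    have tr: "traj g W t x u" "x 0 = z" "l (Suc n) < infdist (x t) C" "infdist (x t) C \<le> l n"
      using Pp by (auto simp: P_def p)
    obtain h z' where h: "h \<le> \<tau> n" "infdist z' C = l (Suc n)"
      "steer g (W \<inter> {(x, u). infdist x C \<le> B n}) h (x t) z'"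
      using stage[OF tr(3,4)] by blast
    \<comment> \<open>The end state is strictly nearer to \<open>C\<close> than the start, so the
      stage cannot have length 0. This makes the stage times strictly increasing.\<close>
    have "0 < h" using steer_positive[OF h(3)] h(2) tr(3) by fastforce
    have t0: "0 \<le> t" using tr(1) by (simp add: traj_def)
    obtain x2 u2 where x2: "traj g W (t + h) x2 u2" "x2 (t + h) = z'" "\<And>s. s\<le>t \<Longrightarrow> x2 s = x s"
      "\<And>s. s<t \<Longrightarrow> u2 s = u s" "\<And>s. s\<in>{t..<t+h} \<Longrightarrow> (x2 s, u2 s) \<in> W \<inter> {(x, u). infdist x C \<le> B n}"
      using traj_extend[OF h(3) tr(1) HOL.refl Int_lower1 continuous_on_subset[OF g Int_lower1]] by blast
    have "P (Suc n) (t + h, x2, u2)"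
      using x2 tr(2) t0 h(2) l[of "Suc n"] by (simp add: P_def)
    moreover have "Q n p (t + h, x2, u2)"
      using x2 \<open>0 < h\<close> h(1) by (fastforce simp: Q_def p)
    ultimately show "\<exists>q. P (Suc n) q \<and> Q n p q" by blast
  qed
  then obtain f where f: "\<And>n. P n (f n)" "\<And>n. Q n (f n) (f (Suc n))" by blast
  define t where "t = (\<lambda>n. fst (f n))"
  define X where "X = (\<lambda>n. fst (snd (f n)))"
  define U where "U = (\<lambda>n. snd (snd (f n)))"
  have ff: "f n = (t n, X n, U n)" for n by (simp add: t_def X_def U_def)
  show thesis
  proof (rule that)
    show "t 0 = 0" using f(1)[of 0] by (simp add: P_def ff)
    show "X j 0 = z" "traj g W (t j) (X j) (U j)" for j using f(1)[of j] by (simp_all add: P_def ff)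
    show "t j < t (Suc j)" "t (Suc j) \<le> t j + \<tau> j" for j using f(2)[of j] by (simp_all add: Q_def ff)
    show "X (Suc j) s = X j s" if "s \<le> t j" for j s using f(2)[of j] that by (simp add: Q_def ff)
    show "U (Suc j) s = U j s" if "s < t j" for j s using f(2)[of j] that by (simp add: Q_def ff)
    show "infdist (X (Suc j) s) C \<le> B j" if "s \<in> {t j..<t (Suc j)}" for j s
      using f(2)[of j] that by (simp add: Q_def ff)
  qed
qed

section \<open>The limit of the concatenated trajectories\<close>

lemma lipschitz_on_imp_abs_continuous_on:
  fixes x :: "real \<Rightarrow> 'a::euclidean_space"
  assumes L: "L-lipschitz_on S x"
  shows "abs_continuous_on S x"
  unfolding abs_continuous_on_def
proof (intro allI impI)
  fix e :: real assume "0 < e"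
  have L0: "0 \<le> L" using L by (rule lipschitz_on_nonneg)
  show "\<exists>\<delta>>0. \<forall>d A. d division_of A \<and> A \<subseteq> S \<and> (\<Sum>k\<in>d. Sup k - Inf k) < \<delta> \<longrightarrow>
        (\<Sum>k\<in>d. norm (x (Sup k) - x (Inf k))) < e"
  proof (intro exI conjI allI impI)
    \<comment> \<open>\<open>L + 1\<close> instead of \<open>L\<close> avoids a division by
      0.\<close>
    show "0 < e / (L + 1)" using \<open>0 < e\<close> L0 by simp
    fix d A assume d: "d division_of A \<and> A \<subseteq> S \<and> (\<Sum>k\<in>d. Sup k - Inf k) < e / (L + 1)"
    have "norm (x (Sup k) - x (Inf k)) \<le> (L + 1) * (Sup k - Inf k)" if "k \<in> d" for k
    proof -
      have dA: "d division_of A" "A \<subseteq> S" using d by auto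
      obtain a b where k: "k = cbox a b" using division_ofD(4)[OF dA(1) \<open>k \<in> d\<close>] by blast
      have "k \<noteq> {}" "k \<subseteq> S" using division_ofD(2,3)[OF dA(1) that] dA(2) by auto
      then have ab: "a \<le> b" "a \<in> S" "b \<in> S" using k by auto
      have "norm (x b - x a) \<le> L * (b - a)"
        using lipschitz_onD[OF L ab(3,2)] ab(1) by (simp add: dist_norm)
      also have "\<dots> \<le> (L + 1) * (b - a)" using ab by (intro mult_right_mono) auto
      finally show ?thesis using ab k by simp
    qed
    then have "(\<Sum>k\<in>d. norm (x (Sup k) - x (Inf k))) \<le> (\<Sum>k\<in>d. (L + 1) * (Sup k - Inf k))"
      by (rule sum_mono)
    also have "\<dots> = (L + 1) * (\<Sum>k\<in>d. Sup k - Inf k)" by (simp add: sum_distrib_left)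
    also have "\<dots> < e" using d L0 by (simp add: field_simps)
    finally show "(\<Sum>k\<in>d. norm (x (Sup k) - x (Inf k))) < e" .
  qed
qed

text \<open>The stage times may accumulate or run to infinity; with \<open>T\<close> as their
  supremum both cases are treated together. For finite \<open>T\<close> the vanishing bounds
  \<open>B\<close> force the distance to 0, and compactness of the boundary supplies the limit point
  needed for the extension.\<close>

lemma admissible_pair_limit:
  fixes g :: "'a::euclidean_space \<times> 'b::euclidean_space \<Rightarrow> 'a"
    and t :: "nat \<Rightarrow> real" and X :: "nat \<Rightarrow> real \<Rightarrow> 'a" and Y :: "nat \<Rightarrow> real \<Rightarrow> 'b"
  assumes C: "C \<noteq> {}" "closed C" "compact (frontier C)"
    and W: "W \<subseteq> (- C) \<times> U"
    and t0: "t 0 = 0" and X0: "\<And>j. X j 0 = z" and tr: "\<And>j. traj g W (t j) (X j) (Y j)"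
    and tinc: "\<And>j. t j < t (Suc j)"
    and XS: "\<And>j s. s \<le> t j \<Longrightarrow> X (Suc j) s = X j s"
    and YS: "\<And>j s. s < t j \<Longrightarrow> Y (Suc j) s = Y j s"
    and dec: "\<And>j s. s \<in> {t j..<t (Suc j)} \<Longrightarrow> infdist (X (Suc j) s) C \<le> B j"
    and B: "antimono B" "B \<longlonglongrightarrow> 0"
  obtains T x u where "admissible_pair C g U T x u" "extended_beyond C T x" "x 0 = z"
    "\<And>s. s \<in> time_dom T \<Longrightarrow> (x s, u s) \<in> W"
    "\<And>s. s \<in> time_dom T \<Longrightarrow> \<exists>j. s \<in> {t j..<t (Suc j)} \<and> infdist (x s) C \<le> B j"
    "\<And>s. 0 \<le> s \<Longrightarrow> s \<notin> time_dom T \<Longrightarrow> infdist (x s) C = 0"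
proof -
  have tmono: "strict_mono t" using tinc by (simp add: strict_mono_Suc_iff)
  then have tle: "i \<le> j \<Longrightarrow> t i \<le> t j" for i j by (simp add: strict_mono_less_eq)
  have tpos: "0 \<le> t j" for j using tle[of 0 j] t0 by simp
  have Xeq: "X j s = X i s" if "i \<le> j" "s \<le> t i" for i j s
    using that(1)
  proof (induction rule: dec_induct)
    case (step n)
    then show ?case using XS[of s n] tle[of i n] that(2) by simp
  qed simp
  have Yeq: "Y j s = Y i s" if "i \<le> j" "s < t i" for i j s
    using that(1)
  proof (induction rule: dec_induct)
    case (step n)
    then show ?case using YS[of s n] tle[of i n] that(2) by simp
  qed simp
  define T where "T = (SUP j. ereal (t j))"
  have T_le: "ereal (t j) < T" for j
    using tinc[of j] SUP_upper[of "Suc j" UNIV "\<lambda>j. ereal (t j)"]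
    unfolding T_def by (meson UNIV_I ereal_less_eq(3) less_le_trans ereal_less(2) less_ereal.simps(1))
  have dom_iff: "s \<in> time_dom T \<longleftrightarrow> 0 \<le> s \<and> (\<exists>j. s < t j)" for s
    unfolding time_dom_def T_def by (auto simp: less_SUP_iff)
  \<comment> \<open>The first index whose trajectory extends past \<open>s\<close>. All later ones
    agree with it at \<open>s\<close>, so \<open>x\<close> and \<open>u\<close> can be evaluated
    with any of them.\<close>
  define N where "N = (\<lambda>s. LEAST j. s < t j)"
  have N: "s < t (N s)" "N s \<le> j" if "s < t j" for s j
    using that unfolding N_def by (rule LeastI, rule Least_le)
  have stage_ex: "\<exists>j. s \<in> {t j..<t (Suc j)}" if "s \<in> time_dom T" for s
  proof -
    obtain i where i: "0 \<le> s" "s < t i" using \<open>s \<in> time_dom T\<close> by (auto simp: dom_iff)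
    have "N s \<noteq> 0" using N(1)[OF i(2)] i(1) t0 by (metis not_le)
    then obtain j where j: "N s = Suc j" by (cases "N s") auto
    have "\<not> s < t j" using N(2)[of s j] j by fastforce
    then show ?thesis using N(1)[OF i(2)] j by (intro exI[of _ j]) auto
  qed
  obtain zl r where zl: "strict_mono r" "T < \<infinity> \<Longrightarrow> zl \<in> frontier C"
      "T < \<infinity> \<Longrightarrow> (\<lambda>i. X (Suc (r i)) (t (r i))) \<longlonglongrightarrow> zl"
  proof -
    \<comment> \<open>\<open>X (Suc i)\<close> rather than \<open>X i\<close> at the time
      \<open>t i\<close>: membership in \<open>W\<close>, and with it avoidance of \<open>C\<close>,
      is known only before the end time of a trajectory.\<close>
    let ?p = "\<lambda>i. X (Suc i) (t i)"
    have d: "infdist (?p i) C \<le> B i" for i using dec[of "t i" i] tinc[of i] by simp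
    have nC: "?p i \<notin> C" for i
    proof -
      have "(?p i, Y (Suc i) (t i)) \<in> W"
        using tr[of "Suc i"] tinc[of i] tpos[of i] by (auto simp: traj_def)
      then show ?thesis using W by auto
    qed
    have "range ?p \<subseteq> {z. infdist z C \<le> B 0} - C"
    proof
      fix q assume "q \<in> range ?p"
      then obtain i where "q = ?p i" by blast
      then show "q \<in> {z. infdist z C \<le> B 0} - C"
        using d[of i] nC[of i] antimonoD[OF B(1), of 0 i] by simp
    qed
    then have "bounded (range ?p)" using bounded_infdist_le[OF C] bounded_subset by blast
    then obtain zl r where r: "strict_mono (r::nat \<Rightarrow> nat)" "(?p \<circ> r) \<longlonglongrightarrow> zl"
      using bounded_imp_convergent_subsequence by blast
    have "(\<lambda>i. infdist ((?p \<circ> r) i) C) \<longlonglongrightarrow> infdist zl C" by (intro tendsto_infdist r)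
    moreover have "(\<lambda>i. infdist ((?p \<circ> r) i) C) \<longlonglongrightarrow> 0"
    proof (rule tendsto_sandwich[OF _ _ tendsto_const])
      show "(\<lambda>i. (B \<circ> r) i) \<longlonglongrightarrow> 0" using LIMSEQ_subseq_LIMSEQ[OF B(2) r(1)] by (simp add: o_def)
    qed (use d in \<open>auto simp: infdist_nonneg\<close>)
    ultimately have "infdist zl C = 0" by (rule LIMSEQ_unique)
    then have "zl \<in> C" using C by (simp add: in_closed_iff_infdist_zero)
    moreover have "zl \<in> closure (- C)"
      unfolding closure_sequential using r(2) nC by (intro exI[of _ "?p \<circ> r"]) auto
    ultimately have "zl \<in> frontier C" using C(2) by (simp add: frontier_closures)
    then show thesis using that[of r zl] r by (simp add: o_def)
  qed
  define x where "x = (\<lambda>s. if \<exists>j. s < t j then X (N s) s else zl)"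
  define u where "u = (\<lambda>s. Y (N s) s)"
  have xX: "x s = X j s" if "s < t j" for s j
    using Xeq[OF N(2)[OF that] less_imp_le[OF N(1)[OF that]]] that by (auto simp: x_def)
  have uY: "u s = Y j s" if "s < t j" for s j
    using Yeq[OF N(2)[OF that] N(1)[OF that]] by (simp add: u_def)
  have inW: "(x s, u s) \<in> W" if "s \<in> time_dom T" for s
  proof -
    obtain j where "0 \<le> s" "s < t j" using \<open>s \<in> time_dom T\<close> by (auto simp: dom_iff)
    then show ?thesis using tr[of j] xX uY by (auto simp: traj_def)
  qed
  have stage_dec: "infdist (x s) C \<le> B j" if "s \<in> {t j..<t (Suc j)}" for s j
    using dec[OF that] xX[of s "Suc j"] that by simp
  have adm: "admissible_pair C g U T x u"
    unfolding admissible_pair_def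
  proof (intro conjI ballI allI impI)
    show "0 < T" using T_le[of 0] t0 by (simp add: zero_ereal_def)
    show "x s \<notin> C" if "s \<in> time_dom T" for s using inW[OF that] W by auto
    show "u \<in> Linf_loc T U"
      unfolding Linf_loc_def
    proof (intro CollectI conjI allI impI)
      show "u \<in> borel_measurable (lebesgue_on (time_dom T))"
      proof (rule borel_measurable_LIMSEQ_metric)
        have "Y j \<in> borel_measurable lebesgue" for j
          using tr[of j] by (simp add: traj_def measurable_completion)
        then show "Y j \<in> borel_measurable (lebesgue_on (time_dom T))" for j
          by (rule measurable_restrict_space1)
        fix s assume "s \<in> space (lebesgue_on (time_dom T))"
        then obtain i where "s < t i" by (auto simp: dom_iff)
        then have "eventually (\<lambda>j. Y j s = u s) sequentially"
          unfolding eventually_sequentially using uY Yeq by (intro exI[of _ i]) auto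
        then show "(\<lambda>j. Y j s) \<longlonglongrightarrow> u s" by (rule tendsto_eventually)
      qed
      show "AE s\<in>time_dom T in lebesgue. u s \<in> U"
        using inW W by (intro AE_I2) auto
      fix K assume K: "compact K \<and> K \<subseteq> time_dom T"
      have "\<exists>j. K \<subseteq> {..<t j}"
      proof (cases "K = {}")
        case False
        then obtain m where "m \<in> K" "\<And>s. s \<in> K \<Longrightarrow> s \<le> m" using K compact_attains_sup[of K] by blast
        then show ?thesis using K by (metis dom_iff in_mono le_less_trans lessThan_iff subsetI)
      qed auto
      then obtain j where j: "K \<subseteq> {..<t j}" ..
      have "bounded (range (Y j))" using tr[of j] by (simp add: traj_def)
      then obtain M where "\<And>s. norm (Y j s) \<le> M" by (auto simp: bounded_iff)
      then have "norm (u s) \<le> M" if "s \<in> K" for s using uY[of s j] j that by auto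
      then show "\<exists>M. AE s\<in>K in lebesgue. norm (u s) \<le> M" by (intro exI[of _ M] AE_I2) auto
    qed
    show "locally_abs_continuous_on (time_dom T) x"
      unfolding locally_abs_continuous_on_def
    proof (intro allI impI)
      fix a b assume ab: "{a..b} \<subseteq> time_dom T"
      show "abs_continuous_on {a..b} x"
      proof (cases "a \<le> b")
        case False
        then have "0-lipschitz_on {a..b} x" by (auto simp: lipschitz_on_def)
        then show ?thesis by (rule lipschitz_on_imp_abs_continuous_on)
      next
        case True
        then obtain j where j: "0 \<le> a" "b < t j" using ab dom_iff[of a] dom_iff[of b] by auto
        obtain L where "L-lipschitz_on {0..t j} (X j)" using tr[of j] by (auto simp: traj_def)
        then have "L-lipschitz_on {a..b} (X j)" by (rule lipschitz_on_subset) (use j in auto)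
        then have "L-lipschitz_on {a..b} x"
          by (rule lipschitz_on_transform) (use j xX[of _ j] in auto)
        then show ?thesis by (rule lipschitz_on_imp_abs_continuous_on)
      qed
    qed
    have "\<exists>F. finite F \<and> (\<forall>s\<in>{0<..<t j} - F. (X j has_vector_derivative g (X j s, Y j s)) (at s))" for j
      using tr[of j] by (simp add: traj_def)
    then obtain F where F: "\<And>j. finite (F j)"
      "\<And>j s. s \<in> {0<..<t j} - F j \<Longrightarrow> (X j has_vector_derivative g (X j s, Y j s)) (at s)" by metis
    \<comment> \<open>Differentiability is known on open intervals only, so the time 0 joins the
      countably many switching times.\<close>
    define Z where "Z = insert 0 (\<Union>j. F j)"
    have "countable Z" unfolding Z_def using F(1) by (auto intro: countable_finite)
    then have "negligible Z" 
    unfolding negligible_iff_null_sets by (intro null_sets_completionI countable_imp_null_set_lborel)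
    moreover have "(x has_vector_derivative g (x s, u s)) (at s within time_dom T)"
      if s: "s \<in> time_dom T - Z" for s
    proof -
      obtain j where j: "0 \<le> s" "s < t j" using s by (auto simp: dom_iff)
      have "(X j has_vector_derivative g (x s, u s)) (at s)"
        using F(2)[of s j] s j xX[OF j(2)] uY[OF j(2)] by (auto simp: Z_def)
      then have "(x has_vector_derivative g (x s, u s)) (at s)"
        by (rule has_vector_derivative_transform_within_open[of _ _ _ "{..<t j}"]) (use j xX in auto)
      then show ?thesis by (rule has_vector_derivative_at_within)
    qed
    ultimately show "AE s\<in>time_dom T in lebesgue. (x has_vector_derivative g (x s, u s)) (at s within time_dom T)"
      by (intro AE_I'[of Z]) (auto simp: negligible_iff_null_sets)
    fix b assume Tb: "T = ereal b"
    show "((\<lambda>s. infdist (x s) C) \<longlongrightarrow> 0) (at_left b)"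
    proof (rule tendstoI)
      fix e :: real assume "0 < e"
      then obtain j where j: "B j < e"
        using order_tendstoD(2)[OF B(2)] by (auto simp: eventually_sequentially)
      have "t j < b" using T_le[of j] Tb by simp
      moreover have "infdist (x s) C < e" if s: "t j < s" "s < b" for s
      proof -
        have "s \<in> time_dom T" using s tpos[of j] Tb by (simp add: time_dom_def)
        then obtain i where i: "s \<in> {t i..<t (Suc i)}" using stage_ex by blast
        \<comment> \<open>A stage of smaller index ends no later than \<open>t j\<close>.\<close>
        have "j \<le> i" using i s tle[of "Suc i" j] by (cases "j \<le> i") auto
        then show ?thesis using stage_dec[OF i] antimonoD[OF B(1), of j i] j by simp
      qed
      ultimately show "eventually (\<lambda>s. dist (infdist (x s) C) 0 < e) (at_left b)"
        unfolding eventually_at_left_field by (intro exI[of _ "t j"]) (auto simp: infdist_nonneg)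
    qed
  qed
  have beyond: "x s = zl" if "ereal s \<ge> T" for s
  proof -
    have "\<not> s < t j" for j using that T_le[of j] by (metis ereal_less_eq(3) less_imp_le not_le order_less_le_trans)
    then show ?thesis by (simp add: x_def)
  qed
  have ext: "extended_beyond C T x"
    unfolding extended_beyond_def
  proof (intro allI impI)
    fix b assume Tb: "T = ereal b"
    then have fin: "T < \<infinity>" by simp
    have lim: "t \<longlonglongrightarrow> b"
    proof -
      have "(\<lambda>j. ereal (t j)) \<longlonglongrightarrow> T"
        unfolding T_def by (rule LIMSEQ_SUP) (use tle in \<open>auto simp: incseq_def\<close>)
      then show ?thesis using Tb by simp
    qed
    show "\<exists>z\<in>frontier C. (\<exists>\<tau>. incseq \<tau> \<and> range \<tau> \<subseteq> time_dom T \<and> \<tau> \<longlonglongrightarrow> b \<and> (\<lambda>i. x (\<tau> i)) \<longlonglongrightarrow> z) \<and>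
           (\<forall>t\<ge>b. x t = z)"
    proof (intro bexI[of _ zl] conjI exI[of _ "t \<circ> r"])
      show "zl \<in> frontier C" using zl(2) fin .
      show "\<forall>t\<ge>b. x t = zl" using beyond Tb by simp
      show "incseq (t \<circ> r)"
        using tle strict_mono_less_eq[OF zl(1)] by (auto simp: incseq_def)
      show "range (t \<circ> r) \<subseteq> time_dom T"
        using tpos by (auto simp: dom_iff intro!: tinc)
      show "(t \<circ> r) \<longlonglongrightarrow> b" by (rule LIMSEQ_subseq_LIMSEQ[OF lim zl(1)])
      show "(\<lambda>i. x ((t \<circ> r) i)) \<longlonglongrightarrow> zl"
        using zl(3)[OF fin] xX[OF tinc] by (simp add: o_def)
    qed
  qed
  show thesis
  proof (rule that[OF adm ext _ inW])
    show "x 0 = z" using xX[of 0 "Suc 0"] tinc[of 0] t0 X0 by simp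
    show "\<exists>j. s \<in> {t j..<t (Suc j)} \<and> infdist (x s) C \<le> B j" if "s \<in> time_dom T" for s
      using stage_ex[OF that] stage_dec by blast
    show "infdist (x s) C = 0" if "0 \<le> s" "s \<notin> time_dom T" for s
    proof -
      have "T \<le> ereal s" using that by (simp add: time_dom_def)
      then have "T < \<infinity>" "x s = zl" using beyond by (auto intro: le_less_trans)
      then show ?thesis using zl(2) C by (auto simp: frontier_def)
    qed
  qed
qed

text \<open>Summation in both directions from the normalisation \<open>\<theta> 0 = 0\<close>; one
  of the two sums is always empty.\<close>

lemma time_levels:
  fixes \<tau> :: "int \<Rightarrow> real"
  obtains \<theta> :: "int \<Rightarrow> real" where "\<And>k. \<theta> k = \<theta> (k - 1) + \<tau> k"
proof
  define \<theta> where "\<theta> = (\<lambda>k. (\<Sum>i\<in>{1..k}. \<tau> i) - (\<Sum>i\<in>{k+1..0}. \<tau> i))"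
  show "\<theta> k = \<theta> (k - 1) + \<tau> k" for k
  proof (cases "1 \<le> k")
    case True
    then have "{1..k} = insert k {1..k-1}" by auto
    then show ?thesis using True by (simp add: \<theta>_def)
  next
    case False
    then have "{k..0} = insert k {k+1..0}" by auto
    then show ?thesis using False by (simp add: \<theta>_def)
  qed
qed

text \<open>The data of the stages are used separately: \<open>M\<close> and \<open>B\<close>
  determine \<open>\<sigma>\<close>, while \<open>\<tau>\<close> and \<open>B\<close> determine
  \<open>\<beta>\<close>. Both are fixed before the initial state is chosen.\<close>

lemma stagewise_steerable_imp_GAC_controls:
  fixes g :: "'a::euclidean_space \<times> 'b::euclidean_space \<Rightarrow> 'a"
  assumes C: "C \<noteq> {}" "closed C" "compact (frontier C)"
    and g: "continuous_on ((- C) \<times> U) g" and S: "stagewise_steerable C g U"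
  shows "\<exists>\<sigma>. continuous_on {0<..} \<sigma> \<and> (\<forall>r>0. \<sigma> r > 0) \<and> GAC_controls C g U \<sigma>"
proof -
  obtain b where b: "(b \<longlongrightarrow> 0) (at_right 0)" "mono_on {0<..} b"
    and st: "\<And>r R. 0 < r \<Longrightarrow> r < R \<Longrightarrow> \<exists>M \<tau>. \<forall>z. r < infdist z C \<and> infdist z C \<le> R \<longrightarrow>
        (\<exists>t z'. t \<le> \<tau> \<and> infdist z' C = r \<and>
           steer g {(x, u). r \<le> infdist x C \<and> infdist x C \<le> b R \<and> u \<in> U \<and> norm u \<le> M} t z z')"
    using S unfolding stagewise_steerable_def by blast
  define B where "B = (\<lambda>k. b (exp (real_of_int k)))"
  have Bmono: "mono B" unfolding B_def by (intro monoI mono_onD[OF b(2)]) auto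
  have Bsmall: "\<exists>k. B k < e" if "0 < e" for e
  proof -
    have "eventually (\<lambda>r. b r < e) (at_right 0)" by (rule order_tendstoD(2)[OF b(1) that])
    then obtain d where d: "0 < d" "\<And>r. 0 < r \<Longrightarrow> r < d \<Longrightarrow> b r < e"
      by (auto simp: eventually_at_right_field)
    define k where "k = \<lfloor>ln d\<rfloor> - 1"
    have "real_of_int k < ln d" unfolding k_def by linarith
    then have "exp (real_of_int k) < d" using d(1) by (metis exp_less_cancel_iff exp_ln)
    then show ?thesis unfolding B_def using d(2) by (intro exI[of _ k]) simp
  qed
  have B0: "0 \<le> B k" for k
  proof -
    have "eventually (\<lambda>r. b r \<le> B k) (at_right 0)"
      unfolding eventually_at_right_field B_def
      by (intro exI[of _ "exp (real_of_int k)"]) (auto intro: mono_onD[OF b(2)])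
    then show ?thesis by (intro tendsto_upperbound[OF b(1)]) auto
  qed
  define Q where "Q = (\<lambda>k M \<tau>. \<forall>z. exp (real_of_int k - 1) < infdist z C \<and> infdist z C \<le> exp (real_of_int k) \<longrightarrow>
        (\<exists>t z'. t \<le> \<tau> \<and> infdist z' C = exp (real_of_int k - 1) \<and>
           steer g {(x, u). exp (real_of_int k - 1) \<le> infdist x C \<and> infdist x C \<le> B k \<and> u \<in> U \<and> norm u \<le> M} t z z'))"
  have "\<forall>k. \<exists>M \<tau>. Q k M \<tau>"
    unfolding Q_def B_def by (intro allI st) auto
  then obtain M \<tau> where Q: "\<And>k. Q k (M k) (\<tau> k)" by metis
  have stage: "\<exists>t z'. t \<le> \<tau> k \<and> infdist z' C = exp (real_of_int k - 1) \<and>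
           steer g {(x, u). exp (real_of_int k - 1) \<le> infdist x C \<and> infdist x C \<le> B k \<and> u \<in> U \<and> norm u \<le> M k} t z z'"
    if "exp (real_of_int k - 1) < infdist z C" "infdist z C \<le> exp (real_of_int k)" for k z
    using Q[of k] that unfolding Q_def by blast
  obtain \<sigma> where \<sigma>: "continuous_on {0<..} \<sigma>" "\<And>r. 0 < r \<Longrightarrow> 0 < \<sigma> r"
    "\<And>k r. exp (real_of_int k - 1) \<le> r \<Longrightarrow> r \<le> B k \<Longrightarrow> M k \<le> \<sigma> r"
    by (rule continuous_control_bound[where M = M, OF Bmono Bsmall]) (assumption, blast)
  \<comment> \<open>Raising the time bounds to at least 1 is harmless and gives the growth by 1 per
    level that the descent rate needs.\<close>
  obtain \<theta> :: "int \<Rightarrow> real" where \<theta>: "\<And>k. \<theta> k = \<theta> (k - 1) + max 1 (\<tau> k)"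
    using time_levels[of "\<lambda>k. max 1 (\<tau> k)"] by blast
  have "\<theta> (k - 1) + 1 \<le> \<theta> k" for k using \<theta>[of k] by simp
  then obtain \<beta> where \<beta>: "\<beta> \<in> KL"
    "\<And>r s j. 0 < r \<Longrightarrow> s < \<theta> \<lceil>ln r\<rceil> - \<theta> (j - 1) \<Longrightarrow> B j \<le> \<beta> r s"
    using KL_level_bound[of \<theta> B] Bmono Bsmall B0 by blast
  \<comment> \<open>The control bound is built into \<open>W\<close>, so it is inherited by the
    concatenated trajectory together with avoidance of \<open>C\<close>.\<close>
  define W where "W = {(x, u). x \<notin> C \<and> u \<in> U \<and> norm u \<le> \<sigma> (infdist x C)}"
  have W: "W \<subseteq> (- C) \<times> U" by (auto simp: W_def)
  have gW: "continuous_on W g" using g W by (rule continuous_on_subset)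
  have sol: "\<exists>T x u. admissible_pair C g U T x u \<and> extended_beyond C T x \<and> x 0 = z \<and>
           (\<forall>t\<ge>0. infdist (x t) C \<le> \<beta> (infdist z C) t) \<and>
           (AE t\<in>time_dom T in lebesgue. norm (u t) \<le> \<sigma> (infdist (x t) C))" if z: "z \<notin> C" for z
  proof -
    have dz: "0 < infdist z C" using C z by (intro infdist_pos_not_in_closed)
    \<comment> \<open>Rounding up puts \<open>z\<close> above the level \<open>exp (k - 1)\<close>
      and not above \<open>exp k\<close>, so the first stage is number \<open>k\<close>. The same
      ceiling occurs in the property of \<open>\<beta>\<close>.\<close>
    define k where "k = \<lceil>ln (infdist z C)\<rceil>"
    define l where "l = (\<lambda>j. exp (real_of_int (k - int j)))"
    have lS: "l (Suc j) = exp (real_of_int (k - int j) - 1)" for j by (simp add: l_def algebra_simps)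
    have "real_of_int k - 1 < ln (infdist z C)" "ln (infdist z C) \<le> real_of_int k"
      unfolding k_def by linarith+
    then have zl: "l (Suc 0) < infdist z C" "infdist z C \<le> l 0"
      using dz unfolding lS by (simp_all add: l_def) (metis exp_less_cancel_iff exp_ln, metis exp_le_cancel_iff exp_ln)
    have st: "\<exists>t\<le>max 1 (\<tau> (k - int j)). \<exists>z'. infdist z' C = l (Suc j) \<and>
        steer g (W \<inter> {(x, u). infdist x C \<le> B (k - int j)}) t z z'"
      if zj: "l (Suc j) < infdist z C" "infdist z C \<le> l j" for j z
    proof -
      let ?k = "k - int j"
      have "exp (real_of_int ?k - 1) < infdist z C" "infdist z C \<le> exp (real_of_int ?k)"
        using zj(1) unfolding lS by assumption (use zj(2) in \<open>simp add: l_def\<close>)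
      note stage_j = stage[OF this]
      obtain t z' where t: "t \<le> \<tau> ?k" "infdist z' C = l (Suc j)"
        "steer g {(x, u). exp (real_of_int ?k - 1) \<le> infdist x C \<and> infdist x C \<le> B ?k \<and> u \<in> U \<and> norm u \<le> M ?k} t z z'"
        using stage_j unfolding lS by blast
      \<comment> \<open>All distances visited in this stage are among those at which
        \<open>\<sigma>\<close> dominates \<open>M ?k\<close>.\<close>
      have "{(x, u). exp (real_of_int ?k - 1) \<le> infdist x C \<and> infdist x C \<le> B ?k \<and> u \<in> U \<and> norm u \<le> M ?k}
          \<subseteq> W \<inter> {(x, u). infdist x C \<le> B ?k}"
      proof
        fix p assume p: "p \<in> {(x, u). exp (real_of_int ?k - 1) \<le> infdist x C \<and> infdist x C \<le> B ?k \<and> u \<in> U \<and> norm u \<le> M ?k}"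
        obtain x u where xu: "p = (x, u)" by (cases p)
        have a: "exp (real_of_int ?k - 1) \<le> infdist x C" "infdist x C \<le> B ?k" "u \<in> U" "norm u \<le> M ?k"
          using p unfolding xu by blast+
        have "0 < infdist x C" using a(1) exp_gt_zero less_le_trans by blast
        moreover have "norm u \<le> \<sigma> (infdist x C)" using \<sigma>(3)[OF a(1,2)] a(4) by simp
        ultimately show "p \<in> W \<inter> {(x, u). infdist x C \<le> B ?k}" using a xu by (auto simp: W_def)
      qed
      then show ?thesis using t steer_mono by (meson max.coboundedI2)
    qed
    have l_less: "l (Suc j) < l j" for j by (simp add: l_def)
    obtain t :: "nat \<Rightarrow> real" and X Y where t: "t 0 = 0" "\<And>j. X j 0 = z" "\<And>j. traj g W (t j) (X j) (Y j)"
      "\<And>j. t j < t (Suc j)" "\<And>j. t (Suc j) \<le> t j + max 1 (\<tau> (k - int j))"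
      "\<And>j s. s \<le> t j \<Longrightarrow> X (Suc j) s = X j s" "\<And>j s. s < t j \<Longrightarrow> Y (Suc j) s = Y j s"
      "\<And>j s. s \<in> {t j..<t (Suc j)} \<Longrightarrow> infdist (X (Suc j) s) C \<le> B (k - int j)"
      apply (rule concatenate_stages[of W g l C "\<lambda>j. max 1 (\<tau> (k - int j))" "\<lambda>j. B (k - int j)" z, OF gW l_less])
      subgoal for j y by (rule st)
      subgoal by (rule zl(1))
      subgoal by (rule zl(2))
      subgoal premises prems for t X Y by (rule that[OF prems(2-9)])
      done
    \<comment> \<open>The stage bounds telescope. Taken at \<open>Suc j\<close>, the estimate shows
      that the potential during stage \<open>k - int j\<close> has not yet dropped to
      \<open>\<theta> (k - int j - 1)\<close>, which is the premise of the bound by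
      \<open>\<beta>\<close>.\<close>
    have t\<theta>: "t j \<le> \<theta> k - \<theta> (k - int j)" for j
    proof (induction j)
      case (Suc j)
      have j: "k - int (Suc j) = k - int j - 1" by simp
      show ?case unfolding j using Suc t(5)[of j] \<theta>[of "k - int j"] by linarith
    qed (simp add: t(1))
    have anti: "antimono (\<lambda>j. B (k - int j))"
      by (intro antimonoI monoD[OF Bmono]) auto
    have lim: "(\<lambda>j. B (k - int j)) \<longlonglongrightarrow> 0"
    proof (rule tendstoI)
      fix e :: real assume "0 < e"
      then obtain m where m: "B m < e" using Bsmall by blast
      have "B (k - int j) < e" if "j \<ge> nat (k - m)" for j
        using monoD[OF Bmono, of "k - int j" m] m that by linarith
      then show "eventually (\<lambda>j. dist (B (k - int j)) 0 < e) sequentially"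
        using B0 by (auto simp: eventually_sequentially dist_real_def)
    qed
    obtain T x u where T: "admissible_pair C g U T x u" "extended_beyond C T x" "x 0 = z"
      "\<And>s. s \<in> time_dom T \<Longrightarrow> (x s, u s) \<in> W"
      "\<And>s. s \<in> time_dom T \<Longrightarrow> \<exists>j. s \<in> {t j..<t (Suc j)} \<and> infdist (x s) C \<le> B (k - int j)"
      "\<And>s. 0 \<le> s \<Longrightarrow> s \<notin> time_dom T \<Longrightarrow> infdist (x s) C = 0"
      apply (rule admissible_pair_limit[of C W U t X z g Y "\<lambda>j. B (k - int j)", OF C W t(1-4) _ _ _ anti lim])
      subgoal by (rule t(6))
      subgoal by (rule t(7))
      subgoal by (rule t(8))
      subgoal premises prems for T x u by (rule that[OF prems(2-7)])
      done
    have "infdist (x s) C \<le> \<beta> (infdist z C) s" if "0 \<le> s" for s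
    proof (cases "s \<in> time_dom T")
      case True
      then obtain j where j: "s < t (Suc j)" "infdist (x s) C \<le> B (k - int j)" using T(5) by auto
      have "k - int (Suc j) = k - int j - 1" by simp
      then have "s < \<theta> k - \<theta> (k - int j - 1)" using j(1) t\<theta>[of "Suc j"] by (metis less_le_trans)
      then have "B (k - int j) \<le> \<beta> (infdist z C) s" unfolding k_def by (rule \<beta>(2)[OF dz])
      then show ?thesis using j(2) by simp
    next
      case False
      have "0 \<le> \<beta> (infdist z C) s" using \<beta>(1) dz that by (simp add: KL_def)
      then show ?thesis using T(6)[OF that False] by simp
    qed
    moreover have "AE s\<in>time_dom T in lebesgue. norm (u s) \<le> \<sigma> (infdist (x s) C)"
      using T(4) by (intro AE_I2) (auto simp: W_def)
    ultimately show ?thesis using T(1-3) by blast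
  qed
  then have "GAC_controls C g U \<sigma>" unfolding GAC_controls_def using \<beta>(1) by blast
  then show ?thesis using \<sigma>(1,2) by blast
qed

section \<open>Equivalences and transfer between the two systems\<close>

lemma GAC_controls_imp_GAC: "GAC_controls C g U \<sigma> \<Longrightarrow> GAC C g U"
  unfolding GAC_controls_def GAC_def by blast

text \<open>The three properties form a cycle: GAC gives stagewise steerability, this gives GAC with
  a control bound, and forgetting the bound gives GAC again.\<close>

lemma GAC_iff_stagewise_steerable:
  fixes g :: "'a::euclidean_space \<times> 'b::euclidean_space \<Rightarrow> 'a"
  assumes C: "C \<noteq> {}" "closed C" "compact (frontier C)"
    and U: "closed U" and g: "continuous_on ((- C) \<times> U) g"
    and lip: "\<And>K U1. compact K \<Longrightarrow> K \<subseteq> - C \<Longrightarrow> compact U1 \<Longrightarrow> U1 \<subseteq> U \<Longrightarrow>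
              \<exists>L>0. \<forall>x\<in>K. \<forall>y\<in>K. \<forall>u\<in>U1. norm (g (x, u) - g (y, u)) \<le> L * norm (x - y)"
  shows "GAC C g U \<longleftrightarrow> stagewise_steerable C g U"
    and "(\<exists>\<sigma>. continuous_on {0<..} \<sigma> \<and> (\<forall>r>0. \<sigma> r > 0) \<and> GAC_controls C g U \<sigma>) \<longleftrightarrow>
      stagewise_steerable C g U" (is "?R \<longleftrightarrow> _")
proof -
  have 1: "stagewise_steerable C g U" if "GAC C g U"
    by (rule GAC_imp_stagewise_steerable[OF C U g _ that]) (erule (3) lip)
  have 2: ?R if "stagewise_steerable C g U"
    by (rule stagewise_steerable_imp_GAC_controls[OF C g that])
  have 3: "GAC C g U" if ?R
    using that by (auto intro: GAC_controls_imp_GAC)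
  show "GAC C g U \<longleftrightarrow> stagewise_steerable C g U" by (rule iffI) (erule 1, rule 3, erule 2)
  show "?R \<longleftrightarrow> stagewise_steerable C g U" by (rule iffI) (rule 1, erule 3, erule 2)
qed

lemma rescaling_nonneg:
  fixes \<nu> :: "real \<Rightarrow> real"
  assumes "bij_betw \<nu> {0..} {0..}" "0 \<le> s"
  shows "0 \<le> \<nu> s"
  using assms by (auto simp: bij_betw_def)

theorem theorem3p2:
  fixes C :: "(real ^ 'n) set" and U :: "(real ^ 'm) set"
    and f :: "(real ^ 'n) \<times> (real ^ 'm) \<Rightarrow> real ^ 'n"
    and \<nu> :: "real \<Rightarrow> real"
  assumes C: "C \<noteq> {}" "closed C" "compact (frontier C)"
    and U: "closed U" "cone U"
    and f: "continuous_on ((- C) \<times> U) f"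
    and a: "\<And>K U1. compact K \<Longrightarrow> K \<subseteq> - C \<Longrightarrow> compact U1 \<Longrightarrow> U1 \<subseteq> U \<Longrightarrow>
              \<exists>L>0. \<forall>x\<in>K. \<forall>y\<in>K. \<forall>u\<in>U1. norm (f (x, u) - f (y, u)) \<le> L * norm (x - y)"
    and \<nu>: "strict_mono_on {0..} \<nu>" "bij_betw \<nu> {0..} {0..}"
    and b_cont: "\<And>K. compact K \<Longrightarrow> K \<subseteq> - C \<Longrightarrow> uniformly_continuous_on (K \<times> U) (rescaled \<nu> f)"
    and b_bdd: "\<And>R. R > 0 \<Longrightarrow> bounded (rescaled \<nu> f ` (({x. infdist x C \<le> R} - C) \<times> U))"
  shows "(GAC C f U \<longleftrightarrow> GAC C (rescaled \<nu> f) U) \<and>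
         (GAC C f U \<longleftrightarrow>
            (\<exists>\<sigma>. continuous_on {0<..} \<sigma> \<and> (\<forall>r>0. \<sigma> r > 0) \<and> GAC_controls C f U \<sigma>)) \<and>
         (GAC C (rescaled \<nu> f) U \<longleftrightarrow>
            (\<exists>\<sigma>. continuous_on {0<..} \<sigma> \<and> (\<forall>r>0. \<sigma> r > 0) \<and> GAC_controls C (rescaled \<nu> f) U \<sigma>))"
proof -
  have \<nu>0: "0 \<le> \<nu> s" if "0 \<le> s" for s by (rule rescaling_nonneg[OF \<nu>(2) that])
  \<comment> \<open>Continuity is local, and the cylinder over a small closed ball around the state
    is a neighbourhood of \<open>p\<close> in the domain, to which \<open>b_cont\<close>
    applies.\<close>
  have contf': "continuous_on ((- C) \<times> U) (rescaled \<nu> f)"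
    unfolding continuous_on_eq_continuous_within
  proof
    fix p assume p: "p \<in> (- C) \<times> U"
    obtain e where e: "0 < e" "cball (fst p) e \<subseteq> - C"
      using p C(2) open_contains_cball[of "- C"] by (auto simp: open_Compl mem_Times_iff)
    have "uniformly_continuous_on (cball (fst p) e \<times> U) (rescaled \<nu> f)"
      using e(2) by (intro b_cont) auto
    then have "continuous_on (cball (fst p) e \<times> U) (rescaled \<nu> f)"
      by (rule uniformly_continuous_imp_continuous)
    then have "continuous (at p within cball (fst p) e \<times> U) (rescaled \<nu> f)"
      using p e(1) by (cases p) (auto simp: continuous_on_eq_continuous_within)
    moreover have "at p within cball (fst p) e \<times> U = at p within (- C) \<times> U"
      by (rule at_within_nhd[of _ "ball (fst p) e \<times> UNIV"])
         (use e ball_subset_cball[of "fst p" e] in \<open>auto simp: mem_Times_iff open_Times\<close>)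
    ultimately show "continuous (at p within (- C) \<times> U) (rescaled \<nu> f)" by simp
  qed
  \<comment> \<open>Both states are divided by the same number
    \<open>1 + \<nu> (norm u) \<ge> 1\<close>, so the Lipschitz constant of \<open>f\<close> still
    serves.\<close>
  have lip': "\<exists>L>0. \<forall>x\<in>K. \<forall>y\<in>K. \<forall>u\<in>U1. norm (rescaled \<nu> f (x, u) - rescaled \<nu> f (y, u)) \<le> L * norm (x - y)"
    if K: "compact K" "K \<subseteq> - C" "compact U1" "U1 \<subseteq> U" for K U1
  proof -
    obtain L where L: "L > 0" "\<And>x y u. x\<in>K \<Longrightarrow> y\<in>K \<Longrightarrow> u\<in>U1 \<Longrightarrow> norm (f (x, u) - f (y, u)) \<le> L * norm (x - y)"
      using a[OF K] by blast
    have "norm (rescaled \<nu> f (x, u) - rescaled \<nu> f (y, u)) \<le> norm (f (x, u) - f (y, u))" for x y u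
    proof -
      have "rescaled \<nu> f (x, u) - rescaled \<nu> f (y, u) = (f (x, u) - f (y, u)) /\<^sub>R (1 + \<nu> (norm u))"
        by (simp add: rescaled_def scaleR_diff_right)
      then have "norm (rescaled \<nu> f (x, u) - rescaled \<nu> f (y, u)) = norm (f (x, u) - f (y, u)) / (1 + \<nu> (norm u))"
        using \<nu>0[of "norm u"] by (simp add: divide_inverse mult.commute)
      also have "\<dots> \<le> norm (f (x, u) - f (y, u)) / 1"
        using \<nu>0[of "norm u"] by (intro divide_left_mono) auto
      finally show ?thesis by simp
    qed
    then show ?thesis using L order_trans by blast
  qed
  have S: "stagewise_steerable C f U \<longleftrightarrow> stagewise_steerable C (rescaled \<nu> f) U"
  proof
    assume "stagewise_steerable C f U"
    then show "stagewise_steerable C (rescaled \<nu> f) U"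
    proof (rule stagewise_steerable_time_change[where \<rho> = "\<lambda>s. inverse (1 + \<nu> s)"])
      show "0 < inverse (1 + \<nu> s)" if "0 \<le> s" for s using \<nu>0[OF that] by simp
      show "\<exists>m\<ge>0. \<forall>s\<in>{0..M}. 1 / inverse (1 + \<nu> s) \<le> m" for M
      proof (intro exI conjI ballI)
        \<comment> \<open>The absolute value covers negative \<open>M\<close>, where nothing is
          known about \<open>\<nu>\<close>.\<close>
        show "0 \<le> 1 + \<bar>\<nu> M\<bar>" by simp
        fix s assume "s \<in> {0..M}"
        then have "\<nu> s \<le> \<nu> M" using strict_mono_onD[OF \<nu>(1), of s M] by (cases "s = M") auto
        then show "1 / inverse (1 + \<nu> s) \<le> 1 + \<bar>\<nu> M\<bar>" by (simp add: divide_inverse)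
      qed
    qed (simp add: rescaled_def)
  next
    assume "stagewise_steerable C (rescaled \<nu> f) U"
    then show "stagewise_steerable C f U"
    proof (rule stagewise_steerable_time_change[where \<rho> = "\<lambda>s. 1 + \<nu> s"])
      show "0 < 1 + \<nu> s" if "0 \<le> s" for s using \<nu>0[OF that] by simp
      \<comment> \<open>In this direction the speed is multiplied by at least 1, so durations do not
        increase and \<open>m = 1\<close> works.\<close>
      show "\<exists>m\<ge>0. \<forall>s\<in>{0..M}. 1 / (1 + \<nu> s) \<le> m" for M
      proof (intro exI conjI ballI)
        fix s assume "s \<in> {0..M}"
        then have "0 \<le> \<nu> s" using \<nu>0 by simp
        then show "1 / (1 + \<nu> s) \<le> 1" by (simp add: divide_le_eq_1)
      qed simp
      show "f (x, u) = (1 + \<nu> (norm u)) *\<^sub>R rescaled \<nu> f (x, u)" for x u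
        using \<nu>0[of "norm u"] by (simp add: rescaled_def)
    qed
  qed
  have GAC_f: "GAC C f U \<longleftrightarrow> stagewise_steerable C f U"
    "(\<exists>\<sigma>. continuous_on {0<..} \<sigma> \<and> (\<forall>r>0. \<sigma> r > 0) \<and> GAC_controls C f U \<sigma>) \<longleftrightarrow>
      stagewise_steerable C f U"
    by (rule GAC_iff_stagewise_steerable[OF C U(1) f], erule (3) a)+
  have GAC_f': "GAC C (rescaled \<nu> f) U \<longleftrightarrow> stagewise_steerable C (rescaled \<nu> f) U"
    "(\<exists>\<sigma>. continuous_on {0<..} \<sigma> \<and> (\<forall>r>0. \<sigma> r > 0) \<and> GAC_controls C (rescaled \<nu> f) U \<sigma>) \<longleftrightarrow>
      stagewise_steerable C (rescaled \<nu> f) U"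
    by (rule GAC_iff_stagewise_steerable[OF C U(1) contf'], erule (3) lip')+
  show ?thesis unfolding GAC_f GAC_f' S by simp
qed

end
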